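(* Let $A$ be a circular $m\times n$ matrix with no dominating rows and let $\alpha$ be a positive integer. Then $Q^*(A,\alpha\mathbf{1})$ is equal to the set of points $x\in\mathbb{R}^n$ satisfying $Ax\ge \alpha\mathbf{1}$, $x\ge 0$, and all $\Gamma$-inequalities (with respect to $b=\alpha\mathbf{1}$) for the circuits $\Gamma$ of $D(A)$ that contain no reverse row arcs, satisfy $p(\Gamma)\ge 2$, and such that $p(\Gamma)$ does not divide $t(\Gamma,\alpha\mathbf{1})$.
   Context: $\mathbf{1}$ is the all-ones vector. Notation: $[n]=\{1,\dots,n\}$ with addition modulo $n$ (index $0$ identified with $n$); for $a,c\in[n]$ with $t\ge0$ minimal such that $a+t\equiv c\pmod n$, $[a,c]_n=\{a,\dots,a+t\}$ (mod $n$), $[a,c)_n=[a,c]_n\setminus\{c\}$. An $m\times n$ $\{0,1\}$-matrix $A$ is circular if for each row $i$ there are $\ell_i\in[n]$ and an integer $k_i$, $2\le k_i\le n-1$, such that row $i$ is the incidence vector of $[\ell_i,\ell_i+k_i)_n$. Row $i$ dominates row $\ell\ne i$ if $a_{ij}\ge a_{\ell j}$ for all $j$; $A$ has no dominating rows if no row dominates another. $Q(A,b)=\{x\in\mathbb{R}^n:Ax\ge b,x\ge0\}$, $Q^*(A,b)=\operatorname{conv}(Q(A,b)\cap\mathbb{Z}^n)$. $D(A)$: node set $[n]$ (labels mod $n$); forward row arcs $a_i=(\ell_i-1,\ell_i+k_i-1)$ ($i\in[m]$), forward short arcs $a_{m+j}=(j-1,j)$ ($j\in[n]$), reverse row arcs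 $\bar a_i=(\ell_i+k_i-1,\ell_i-1)$, reverse short arcs $\bar a_{m+j}=(j,j-1)$. Lengths $k_i$, $1$, $-k_i$, $-1$ respectively. A circuit is a simple directed circuit; its winding number $p(\Gamma)$ satisfies $p(\Gamma)n=\sum_{a\in E(\Gamma)}l(a)$. A forward row arc $a_i$ jumps over $j$ iff $j\in[\ell_i,\ell_i+k_i)_n$; $(j-1,j)$ jumps over $j$ only; a reverse arc $\bar a_k$ jumps over $j$ iff $a_k$ does; $p^-(\Gamma,j)$ = number of reverse arcs of $\Gamma$ jumping over $j$. For a circuit $\Gamma$ and $b\in\mathbb{Z}_+^m$: $t(\Gamma,b)=\sum_{i:a_i\in E(\Gamma)}b_i-\sum_{i:\bar a_i\in E(\Gamma)}b_i$; for $p(\Gamma)\ne0$, $\beta=\lfloor t(\Gamma,b)/p(\Gamma)\rfloor$, $r=t(\Gamma,b)-\beta p(\Gamma)$, and the $\Gamma$-inequality is $\sum_{j\in[n]}[p^-(\Gamma,j)+r]x_j\ge r(\beta+1)+\sum_{i:\bar a_i\in E(\Gamma)}b_i$. *)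

theory Defs
  imports "HOL-Analysis.Analysis" "HOL-Library.Function_Algebras"
begin

section \<open>Real vector space structure on nat => real (pointwise), so that the
  library's convex hull can be used for points of R^n\<close>

instantiation "fun" :: (type, real_vector) real_vector
begin
definition scaleR_fun_def: "scaleR c f = (\<lambda>x. c *\<^sub>R f x)"
instance
  by standard (auto simp: scaleR_fun_def fun_eq_iff scaleR_add_right scaleR_add_left)
end

definition Rn :: "nat \<Rightarrow> (nat \<Rightarrow> real) set" where
  "Rn n = {x. \<forall>j. j \<notin> {1..n} \<longrightarrow> x j = 0}"

definition int_points :: "nat \<Rightarrow> (nat \<Rightarrow> real) set" where
  "int_points n = {x \<in> Rn n. \<forall>j\<in>{1..n}. x j \<in> \<int>}"

definition cinterval :: "nat \<Rightarrow> nat \<Rightarrow> nat \<Rightarrow> nat set" where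
  "cinterval n a k = {j \<in> {1..n}. (int j - int a) mod int n < int k}"

definition circular_wrt :: "(nat \<Rightarrow> nat \<Rightarrow> int) \<Rightarrow> nat \<Rightarrow> nat \<Rightarrow> (nat \<Rightarrow> nat) \<Rightarrow> (nat \<Rightarrow> nat) \<Rightarrow> bool" where
  "circular_wrt A m n l k \<longleftrightarrow>
     (\<forall>i\<in>{1..m}. l i \<in> {1..n} \<and> 2 \<le> k i \<and> k i \<le> n - 1 \<and>
        (\<forall>j\<in>{1..n}. A i j = (if j \<in> cinterval n (l i) (k i) then 1 else 0)))"

definition circular :: "(nat \<Rightarrow> nat \<Rightarrow> int) \<Rightarrow> nat \<Rightarrow> nat \<Rightarrow> bool" where
  "circular A m n \<longleftrightarrow> (\<exists>l k. circular_wrt A m n l k)"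

definition dominates :: "(nat \<Rightarrow> nat \<Rightarrow> int) \<Rightarrow> nat \<Rightarrow> nat \<Rightarrow> nat \<Rightarrow> bool" where
  "dominates A n i i' \<longleftrightarrow> (\<forall>j\<in>{1..n}. A i j \<ge> A i' j)"

definition no_dominating_rows :: "(nat \<Rightarrow> nat \<Rightarrow> int) \<Rightarrow> nat \<Rightarrow> nat \<Rightarrow> bool" where
  "no_dominating_rows A m n \<longleftrightarrow> (\<forall>i\<in>{1..m}. \<forall>i'\<in>{1..m}. i \<noteq> i' \<longrightarrow> \<not> dominates A n i i')"

definition Qpoly :: "(nat \<Rightarrow> nat \<Rightarrow> int) \<Rightarrow> nat \<Rightarrow> nat \<Rightarrow> (nat \<Rightarrow> int) \<Rightarrow> (nat \<Rightarrow> real) set" where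
  "Qpoly A m n b = {x \<in> Rn n. (\<forall>i\<in>{1..m}. (\<Sum>j=1..n. real_of_int (A i j) * x j) \<ge> real_of_int (b i))
                            \<and> (\<forall>j\<in>{1..n}. x j \<ge> 0)}"

definition Qstar :: "(nat \<Rightarrow> nat \<Rightarrow> int) \<Rightarrow> nat \<Rightarrow> nat \<Rightarrow> (nat \<Rightarrow> int) \<Rightarrow> (nat \<Rightarrow> real) set" where
  "Qstar A m n b = convex hull (Qpoly A m n b \<inter> int_points n)"

text \<open>Arcs of D(A): Arc True i is the forward arc a_i, Arc False i the reverse arc \<bar>a_i,
  for i \<in> {1..m+n}; i \<le> m are row arcs, i = m + j are short arcs (j \<in> [n]).
  Nodes are the residues mod n (node label n is identified with 0), represented in {0..n-1}.\<close>
datatype arc = Arc bool nat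

definition arc_set :: "nat \<Rightarrow> nat \<Rightarrow> arc set" where
  "arc_set m n = {Arc d i | d i. i \<in> {1..m+n}}"

definition fw_tail :: "nat \<Rightarrow> nat \<Rightarrow> (nat \<Rightarrow> nat) \<Rightarrow> (nat \<Rightarrow> nat) \<Rightarrow> nat \<Rightarrow> int" where
  "fw_tail m n l k i = (if i \<le> m then (int (l i) - 1) mod int n else (int (i - m) - 1) mod int n)"

definition fw_head :: "nat \<Rightarrow> nat \<Rightarrow> (nat \<Rightarrow> nat) \<Rightarrow> (nat \<Rightarrow> nat) \<Rightarrow> nat \<Rightarrow> int" where
  "fw_head m n l k i = (if i \<le> m then (int (l i) + int (k i) - 1) mod int n else int (i - m) mod int n)"

fun tail :: "nat \<Rightarrow> nat \<Rightarrow> (nat \<Rightarrow> nat) \<Rightarrow> (nat \<Rightarrow> nat) \<Rightarrow> arc \<Rightarrow> int" where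
  "tail m n l k (Arc d i) = (if d then fw_tail m n l k i else fw_head m n l k i)"

fun head :: "nat \<Rightarrow> nat \<Rightarrow> (nat \<Rightarrow> nat) \<Rightarrow> (nat \<Rightarrow> nat) \<Rightarrow> arc \<Rightarrow> int" where
  "head m n l k (Arc d i) = (if d then fw_head m n l k i else fw_tail m n l k i)"

fun arc_len :: "nat \<Rightarrow> (nat \<Rightarrow> nat) \<Rightarrow> arc \<Rightarrow> int" where
  "arc_len m k (Arc d i) = (if i \<le> m then int (k i) else 1) * (if d then 1 else -1)"

definition is_circuit :: "nat \<Rightarrow> nat \<Rightarrow> (nat \<Rightarrow> nat) \<Rightarrow> (nat \<Rightarrow> nat) \<Rightarrow> arc list \<Rightarrow> bool" where
  "is_circuit m n l k cs \<longleftrightarrow> cs \<noteq> [] \<and> set cs \<subseteq> arc_set m n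
     \<and> (\<forall>t < length cs. head m n l k (cs ! t) = tail m n l k (cs ! ((t + 1) mod length cs)))
     \<and> distinct (map (tail m n l k) cs)"

text \<open>Winding number: p(\<Gamma>) n = sum of arc lengths.\<close>
definition winding :: "nat \<Rightarrow> nat \<Rightarrow> (nat \<Rightarrow> nat) \<Rightarrow> arc list \<Rightarrow> int" where
  "winding m n k cs = (\<Sum>a\<in>set cs. arc_len m k a) div int n"

definition jumps :: "nat \<Rightarrow> nat \<Rightarrow> (nat \<Rightarrow> nat) \<Rightarrow> (nat \<Rightarrow> nat) \<Rightarrow> nat \<Rightarrow> nat \<Rightarrow> bool" where
  "jumps m n l k i j \<longleftrightarrow> (if i \<le> m then j \<in> cinterval n (l i) (k i) else j = i - m)"

definition p_minus :: "nat \<Rightarrow> nat \<Rightarrow> (nat \<Rightarrow> nat) \<Rightarrow> (nat \<Rightarrow> nat) \<Rightarrow> arc list \<Rightarrow> nat \<Rightarrow> nat" where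
  "p_minus m n l k cs j = card {i. Arc False i \<in> set cs \<and> jumps m n l k i j}"

definition t_val :: "nat \<Rightarrow> arc list \<Rightarrow> (nat \<Rightarrow> int) \<Rightarrow> int" where
  "t_val m cs b = (\<Sum>i\<in>{i\<in>{1..m}. Arc True i \<in> set cs}. b i) - (\<Sum>i\<in>{i\<in>{1..m}. Arc False i \<in> set cs}. b i)"

text \<open>The \<Gamma>-inequality (for p(\<Gamma>) \<noteq> 0), as the set of points satisfying it.\<close>
definition gamma_ineq :: "nat \<Rightarrow> nat \<Rightarrow> (nat \<Rightarrow> nat) \<Rightarrow> (nat \<Rightarrow> nat) \<Rightarrow> arc list \<Rightarrow> (nat \<Rightarrow> int) \<Rightarrow> (nat \<Rightarrow> real) set" where
  "gamma_ineq m n l k cs b =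
     (let p = winding m n k cs; t = t_val m cs b; \<beta> = t div p; r = t - \<beta> * p in
      {x. (\<Sum>j=1..n. real_of_int (int (p_minus m n l k cs j) + r) * x j)
            \<ge> real_of_int (r * (\<beta> + 1) + (\<Sum>i\<in>{i\<in>{1..m}. Arc False i \<in> set cs}. b i))})"

end

theory Submission
  imports Defs
begin

text \<open>Let \<open>\<beta> = \<lfloor>1x\<rfloor>\<close>. The slices of \<open>Q(A, \<alpha>1)\<close> with integral coordinate sum are integral, so
  \<open>x\<close> lies in \<open>Q\<^sup>*\<close> as soon as it is a convex combination of points in the slices \<open>\<beta>\<close> and \<open>\<beta> + 1\<close>.
  The existence of such a combination is a system of difference constraints on the nodes of \<open>D(A)\<close>, solvable
  iff no closed walk has positive gain. A reverse row arc that is followed, up to short arcs, by a forward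
  row arc can be traded for short arcs without loss, because all right-hand sides are equal. Hence only closed
  walks without reverse row arcs matter (those without forward row arcs never have positive gain);
  these decompose into circuits, for which a positive gain is exactly a violated \<open>\<Gamma>\<close>-inequality
  with \<open>p \<ge> 2\<close> and \<open>p\<close> not dividing \<open>t\<close>.\<close>

section \<open>Quasi-periodic lifts\<close>

text \<open>\<open>Y\<close> is the prefix sum function of \<open>y\<close>, unrolled to the
  universal cover of the cycle; a full turn adds \<open>c\<close>. Sums over cyclic intervals become
  differences of \<open>Y\<close> without a wrap-around case. \<open>Y\<close> is determined only up
  to an additive constant.\<close>

definition prefix_lift :: "nat \<Rightarrow> (nat \<Rightarrow> real) \<Rightarrow> real \<Rightarrow> (int \<Rightarrow> real) \<Rightarrow> bool" where
  "prefix_lift n y c Y \<longleftrightarrow>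
     (\<forall>z. Y (z + int n) = Y z + c) \<and> (\<forall>j\<in>{1..n}. y j = Y (int j) - Y (int j - 1))"

lemma prefix_lift_shift:
  assumes "prefix_lift n y c Y"
  shows "Y (z + int n * q) = Y z + c * real_of_int q"
proof (induction q rule: int_induct[where k = 0])
  case base
  then show ?case by simp
next
  case (step1 i)
  have "Y (z + int n * (i + 1)) = Y ((z + int n * i) + int n)" by (simp add: algebra_simps)
  also have "\<dots> = Y (z + int n * i) + c" using assms unfolding prefix_lift_def by blast
  finally show ?case using step1 by (simp add: algebra_simps)
next
  case (step2 i)
  have "Y (z + int n * i) = Y ((z + int n * (i - 1)) + int n)" by (simp add: algebra_simps)
  also have "\<dots> = Y (z + int n * (i - 1)) + c" using assms unfolding prefix_lift_def by blast
  finally show ?case using step2 by (simp add: algebra_simps)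
qed

lemma prefix_lift_cong_diff:
  assumes "prefix_lift n y c Y" and "z mod int n = z' mod int n"
  shows "Y (z + d) - Y z = Y (z' + d) - Y z'"
proof -
  obtain q where q: "z = z' + int n * q"
    using assms(2) by (metis mod_eqE add.commute mult.commute)
  have "Y (z + d) = Y (z' + d + int n * q)" by (simp add: q algebra_simps)
  then show ?thesis
    using prefix_lift_shift[OF assms(1), of "z' + d" q] prefix_lift_shift[OF assms(1), of z' q] q
    by simp
qed

lemma prefix_lift_step:
  assumes "prefix_lift n y c Y" "n > 0"
  shows "y (Suc (nat (z mod int n))) = Y (z + 1) - Y z"
proof -
  have j: "Suc (nat (z mod int n)) \<in> {1..n}"
    using assms(2) by (simp add: nat_less_iff Suc_le_eq)
  have "y (Suc (nat (z mod int n))) = Y (z mod int n + 1) - Y (z mod int n)"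
    using assms j unfolding prefix_lift_def by (auto simp: add.commute)
  then show ?thesis
    using prefix_lift_cong_diff[OF assms(1), of "z mod int n" z 1] by simp
qed

lemma prefix_lift_mono:
  assumes "prefix_lift n y c Y" "n > 0" "\<And>j. j \<in> {1..n} \<Longrightarrow> y j \<ge> 0"
  shows "mono Y"
proof -
  have step: "Y z \<le> Y (z + 1)" for z
  proof -
    have "Suc (nat (z mod int n)) \<in> {1..n}"
      using assms(2) by (simp add: nat_less_iff Suc_le_eq)
    then show ?thesis using prefix_lift_step[OF assms(1,2), of z] assms(3) by fastforce
  qed
  show ?thesis
  proof
    fix a b :: int assume "a \<le> b"
    then show "Y a \<le> Y b"
      by (induction b rule: int_ge_induct) (use step order_trans in blast)+
  qed
qed

text \<open>Telescoping: raising \<open>k\<close> by one adds exactly the representative of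
  \<open>a + k\<close> in \<open>{1..n}\<close>. The bound \<open>k \<le> n\<close> keeps that index
  from having been counted before.\<close>

lemma sum_cinterval:
  assumes "prefix_lift n y c Y" "n > 0" "k \<le> n"
  shows "(\<Sum>j\<in>cinterval n a k. y j) = Y (int a - 1 + int k) - Y (int a - 1)"
  using assms(3)
proof (induction k)
  case 0
  have "cinterval n a 0 = {}" using assms(2) by (auto simp: cinterval_def not_less)
  then show ?case by simp
next
  case (Suc k)
  define z where "z = int a - 1 + int k"
  define j where "j = Suc (nat (z mod int n))"
  have intj: "int j = z mod int n + 1" using assms(2) by (simp add: j_def)
  have jn: "j \<in> {1..n}"
    using assms(2) by (simp add: j_def nat_less_iff Suc_le_eq)
  have jmod: "(int j - int a) mod int n = int k"
  proof -
    have "(int j - int a) mod int n = (z + 1 - int a) mod int n"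
      unfolding intj by (metis mod_diff_left_eq mod_add_left_eq)
    also have "\<dots> = int k" using Suc.prems by (simp add: z_def)
    finally show ?thesis .
  qed
  have uniq: "i = j" if "i \<in> {1..n}" "(int i - int a) mod int n = int k" for i
  proof -
    have "int i mod int n = int j mod int n"
      using that(2) jmod by (metis diff_add_cancel mod_add_left_eq)
    then have "int n dvd int i - int j" by (simp add: mod_eq_dvd_iff)
    moreover have "\<bar>int i - int j\<bar> < int n" using that(1) jn by auto
    ultimately show ?thesis using dvd_imp_le_int[of "int i - int j" "int n"] by auto
  qed
  have "i \<in> cinterval n a (Suc k) \<longleftrightarrow>
      i \<in> cinterval n a k \<or> (i \<in> {1..n} \<and> (int i - int a) mod int n = int k)" for i
    unfolding cinterval_def by (simp only: mem_Collect_eq of_nat_Suc) linarith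
  then have "cinterval n a (Suc k) = insert j (cinterval n a k)"
    using jn jmod uniq by blast
  moreover have "j \<notin> cinterval n a k" using jmod by (simp add: cinterval_def)
  moreover have "finite (cinterval n a k)" by (simp add: cinterval_def)
  ultimately have "(\<Sum>i\<in>cinterval n a (Suc k). y i) = y j + (Y z - Y (int a - 1))"
    using Suc by (simp add: z_def)
  also have "y j = Y (z + 1) - Y z"
    unfolding j_def by (rule prefix_lift_step[OF assms(1,2)])
  finally show ?case by (simp add: z_def algebra_simps)
qed

lemma prefix_lift_sum:
  assumes "prefix_lift n y c Y" "n > 0"
  shows "(\<Sum>j=1..n. y j) = c"
proof -
  have "cinterval n 1 n = {1..n}" using assms(2) by (auto simp: cinterval_def)
  then show ?thesis
    using sum_cinterval[OF assms order_refl, of 1] assms(1) unfolding prefix_lift_def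
    by (metis add.commute add_diff_cancel_left' diff_self of_nat_1)
qed

lemma prefix_lift_exists:
  assumes "n > 0"
  shows "\<exists>Y. prefix_lift n y (\<Sum>j=1..n. y j) Y"
proof -
  define c where "c = (\<Sum>j=1..n. y j)"
  \<comment> \<open>Each completed turn contributes \<open>c\<close>; the remainder is an ordinary
    prefix sum.\<close>
  define Y where "Y = (\<lambda>z. c * real_of_int (z div int n) + (\<Sum>j=1..nat (z mod int n). y j))"
  have "Y (z + int n) = Y z + c" for z
    using assms by (simp add: Y_def algebra_simps)
  moreover have "y j = Y (int j) - Y (int j - 1)" if "j \<in> {1..n}" for j
  proof -
    from that obtain i where i: "j = Suc i" by (cases j) auto
    have Yi: "Y (int i) = (\<Sum>j=1..i. y j)"
      using that i by (simp add: Y_def)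
    have "Y (int j) = (\<Sum>j=1..j. y j)"
    \<comment> \<open>At \<open>j = n\<close> the residue is 0: the prefix sum is empty and
      \<open>c\<close> comes from the completed turn instead.\<close>
    proof (cases "j = n")
      case True
      then show ?thesis using assms by (simp add: Y_def c_def)
    next
      case False
      then show ?thesis using that by (simp add: Y_def)
    qed
    with Yi show ?thesis by (simp add: i)
  qed
  ultimately show ?thesis unfolding prefix_lift_def c_def by blast
qed

section \<open>Slices of integral coordinate sum\<close>

lemma row_sum:
  assumes "circular_wrt A m n l k" "i \<in> {1..m}"
  shows "(\<Sum>j=1..n. real_of_int (A i j) * x j) = (\<Sum>j\<in>cinterval n (l i) (k i). x j)"
proof -
  have "(\<Sum>j=1..n. real_of_int (A i j) * x j)
      = (\<Sum>j=1..n. if j \<in> cinterval n (l i) (k i) then x j else 0)"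
    using assms by (intro sum.cong) (auto simp: circular_wrt_def)
  also have "\<dots> = (\<Sum>j\<in>{1..n} \<inter> cinterval n (l i) (k i). x j)"
    by (simp add: sum.inter_restrict)
  also have "{1..n} \<inter> cinterval n (l i) (k i) = cinterval n (l i) (k i)"
    by (auto simp: cinterval_def)
  finally show ?thesis .
qed

text \<open>Row inequalities and nonnegativity both turn into lower bounds on differences of
  \<open>X\<close>, a form that rounding respects.\<close>

lemma Qpoly_lift_iff:
  assumes "circular_wrt A m n l k" "n > 0" "prefix_lift n x c X"
  shows "x \<in> Qpoly A m n b \<longleftrightarrow> x \<in> Rn n
    \<and> (\<forall>i\<in>{1..m}. X (int (l i) - 1 + int (k i)) - X (int (l i) - 1) \<ge> real_of_int (b i))
    \<and> (\<forall>j\<in>{1..n}. X (int j) \<ge> X (int j - 1))"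
proof -
  have "k i \<le> n - 1" if "i \<in> {1..m}" for i
    using assms(1) that by (simp add: circular_wrt_def)
  then have "k i \<le> n" if "i \<in> {1..m}" for i
    using that by (meson diff_le_self le_trans)
  then have "(\<Sum>j=1..n. real_of_int (A i j) * x j)
      = X (int (l i) - 1 + int (k i)) - X (int (l i) - 1)" if "i \<in> {1..m}" for i
    using row_sum[OF assms(1) that] sum_cinterval[OF assms(3,2)] that by simp
  moreover have "x j \<ge> 0 \<longleftrightarrow> X (int j) \<ge> X (int j - 1)" if "j \<in> {1..n}" for j
    using assms(3) that by (simp add: prefix_lift_def)
  ultimately show ?thesis unfolding Qpoly_def by auto
qed

text \<open>A finite form of the fact that the integral of \<lfloor>y + \<theta>\<rfloor> over
  \<theta> in [0,1) is y. The integrand jumps at most once there, at \<open>1 - frac y\<close>, so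
  the grid has to contain this point; the stretch after it has length \<open>frac y\<close>. For
  integral y the point is 1 and no jump occurs.\<close>

lemma floor_average:
  fixes t :: "nat \<Rightarrow> real"
  assumes mono: "\<And>i j. i \<le> j \<Longrightarrow> j \<le> N \<Longrightarrow> t i \<le> t j"
    and smono: "\<And>i j. i < j \<Longrightarrow> j \<le> N \<Longrightarrow> t i < t j"
    and ends: "t 0 = 0" "t N = 1"
    and r: "r \<le> N" "t r = 1 - frac y"
  shows "(\<Sum>i<N. (t (Suc i) - t i) * real_of_int \<lfloor>y + t i\<rfloor>) = y"
proof -
  have fl: "\<lfloor>y + t i\<rfloor> = \<lfloor>y\<rfloor> + (if r \<le> i then 1 else 0)" if "i < N" for i
  proof -
    have t1: "0 \<le> t i" "t i < 1" using mono[of 0 i] smono[of i N] that ends by auto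
    show ?thesis
    proof (cases "r \<le> i")
      case True
      then have "1 - frac y \<le> t i" using mono[of r i] r that by simp
      then show ?thesis using True t1 unfolding frac_def by (simp add: floor_eq_iff) linarith
    next
      case False
      then have "t i < 1 - frac y" using smono[of i r] r by simp
      then show ?thesis using False t1 unfolding frac_def by (simp add: floor_eq_iff) linarith
    qed
  qed
  have "(\<Sum>i<N. (t (Suc i) - t i) * real_of_int \<lfloor>y + t i\<rfloor>)
     = (\<Sum>i<N. (t (Suc i) - t i) * \<lfloor>y\<rfloor> + (if r \<le> i then t (Suc i) - t i else 0))"
    by (intro sum.cong) (auto simp: fl algebra_simps)
  also have "\<dots> = (\<Sum>i<N. t (Suc i) - t i) * \<lfloor>y\<rfloor> + (\<Sum>i<N. if r \<le> i then t (Suc i) - t i else 0)"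
    by (simp add: sum.distrib sum_distrib_right)
  also have "(\<Sum>i<N. if r \<le> i then t (Suc i) - t i else 0) = (\<Sum>i\<in>{r..<N}. t (Suc i) - t i)"
    by (intro sum.mono_neutral_cong_right) auto
  also have "\<dots> = frac y" using sum_Suc_diff'[of r N t] r ends by simp
  also have "(\<Sum>i<N. t (Suc i) - t i) = 1" using sum_lessThan_telescope[of t N] ends by simp
  finally show ?thesis by (simp add: frac_def)
qed

text \<open>If the coordinate sum is an integer, rounding the lift to \<open>\<lfloor>X + \<theta>\<rfloor>\<close> keeps it quasi-periodic
  and keeps every row inequality, and \<open>X\<close> is the average of these roundings over \<open>\<theta> \<in> [0,1)\<close>.\<close>

lemma integral_slice:
  assumes circ: "circular_wrt A m n l k" and n: "n > 0"
    and x: "x \<in> Qpoly A m n b" and \<beta>: "(\<Sum>j=1..n. x j) = real_of_int \<beta>"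
  shows "x \<in> Qstar A m n b"
proof -
  obtain X where X: "prefix_lift n x (real_of_int \<beta>) X"
    using prefix_lift_exists[OF n, of x] \<beta> by auto
  have Qx: "x \<in> Rn n"
    "\<And>i. i \<in> {1..m} \<Longrightarrow> X (int (l i) - 1 + int (k i)) - X (int (l i) - 1) \<ge> real_of_int (b i)"
    "\<And>j. j \<in> {1..n} \<Longrightarrow> X (int j) \<ge> X (int j - 1)"
    using x Qpoly_lift_iff[OF circ n X] by auto
  define y where "y \<theta> j = (if j \<in> {1..n} then real_of_int (\<lfloor>X (int j) + \<theta>\<rfloor> - \<lfloor>X (int j - 1) + \<theta>\<rfloor>) else 0)"
    for \<theta> :: real and j
  have Y: "prefix_lift n (y \<theta>) (real_of_int \<beta>) (\<lambda>z. real_of_int \<lfloor>X z + \<theta>\<rfloor>)" for \<theta>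
  proof -
    have "X (z + int n) + \<theta> = (X z + \<theta>) + real_of_int \<beta>" for z
      using X by (simp add: prefix_lift_def)
    \<comment> \<open>Since \<beta> is an integer, the shift by a full turn passes through the
      floor.\<close>
    then have "\<lfloor>X (z + int n) + \<theta>\<rfloor> = \<lfloor>X z + \<theta>\<rfloor> + \<beta>" for z by (metis floor_add_int)
    then show ?thesis by (simp add: prefix_lift_def y_def)
  qed
  have yQ: "y \<theta> \<in> Qpoly A m n b \<inter> int_points n" for \<theta>
  proof -
    \<comment> \<open>An integral lower bound on a difference survives rounding both ends
      down.\<close>
    have "real_of_int \<lfloor>u + \<theta>\<rfloor> - real_of_int \<lfloor>v + \<theta>\<rfloor> \<ge> real_of_int c" if "u - v \<ge> real_of_int c" for u v c
    proof -
      have "\<lfloor>v + \<theta>\<rfloor> + c \<le> \<lfloor>u + \<theta>\<rfloor>" using that by linarith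
      then show ?thesis by linarith
    qed
    then have "y \<theta> \<in> Qpoly A m n b"
      unfolding Qpoly_lift_iff[OF circ n Y] using Qx by (auto simp: Rn_def y_def intro!: floor_mono)
    moreover have "y \<theta> \<in> int_points n" by (auto simp: int_points_def Rn_def y_def)
    ultimately show ?thesis by blast
  qed
  \<comment> \<open>The endpoints and every \<theta> at which some rounded \<open>X j\<close> can
    jump; \<open>j = 0\<close> is included because coordinate 1 is the difference of the lift at 1
    and at 0.\<close>
  define S where "S = {0, 1} \<union> (\<lambda>j. 1 - frac (X (int j))) ` {0..n}"
  have S: "finite S" "S \<subseteq> {0..1}" "0 \<in> S" "1 \<in> S"
    by (auto simp: S_def frac_ge_0 less_imp_le[OF frac_lt_1])
  define ts where "ts = sorted_list_of_set S"
  have ts: "set ts = S" "sorted_wrt (<) ts" "length ts = card S" using S by (simp_all add: ts_def)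
  define N where "N = length ts - 1"
  have len: "length ts = Suc N"
    using ts(1) S(3) by (cases ts) (auto simp: N_def)
  have smono: "ts ! i < ts ! j" if "i < j" "j \<le> N" for i j
    using sorted_wrt_nth_less[OF ts(2)] that len by simp
  have mono: "ts ! i \<le> ts ! j" if "i \<le> j" "j \<le> N" for i j
    using smono[of i j] that by (cases "i = j") auto
  have in01: "ts ! i \<in> {0..1}" if "i \<le> N" for i
    using that len ts S by (metis le_imp_less_Suc nth_mem subsetD)
  obtain r0 where r0: "r0 \<le> N" "ts ! r0 = 0"
    using S ts len by (metis in_set_conv_nth less_Suc_eq_le)
  obtain r1 where r1: "r1 \<le> N" "ts ! r1 = 1"
    using S ts len by (metis in_set_conv_nth less_Suc_eq_le)
  have ends: "ts ! 0 = 0" "ts ! N = 1"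
    using mono[of 0 r0] mono[of r1 N] in01[of 0] in01[of N] r0 r1 by auto
  have avg: "(\<Sum>i<N. (ts ! Suc i - ts ! i) * real_of_int \<lfloor>X (int j) + ts ! i\<rfloor>) = X (int j)"
    if "j \<le> n" for j
  proof -
    have "1 - frac (X (int j)) \<in> set ts" using that ts(1) by (auto simp: S_def)
    then obtain r where "r \<le> N" "ts ! r = 1 - frac (X (int j))"
      using len by (metis in_set_conv_nth less_Suc_eq_le)
    then show ?thesis using floor_average[of N "(!) ts" r] mono smono ends by blast
  qed
  have "x = (\<Sum>i<N. (ts ! Suc i - ts ! i) *\<^sub>R y (ts ! i))"
  proof
    fix j
    have sumj: "(\<Sum>i<N. (ts ! Suc i - ts ! i) *\<^sub>R y (ts ! i)) j = (\<Sum>i<N. (ts ! Suc i - ts ! i) * y (ts ! i) j)"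
      by (induction N) (auto simp: scaleR_fun_def)
    show "x j = (\<Sum>i<N. (ts ! Suc i - ts ! i) *\<^sub>R y (ts ! i)) j"
    proof (cases "j \<in> {1..n}")
      case True
      then obtain j' where j': "j = Suc j'" by (cases j) auto
      have "(\<Sum>i<N. (ts ! Suc i - ts ! i) * y (ts ! i) j) = X (int j) - X (int j')"
        using True j' avg[of j, symmetric] avg[of j', symmetric]
        by (simp add: y_def algebra_simps sum_subtractf sum.distrib)
      also have "\<dots> = x j" using X True j' by (auto simp: prefix_lift_def)
      finally show ?thesis using sumj by simp
    next
      case False
      then have "x j = 0" "\<And>\<theta>. y \<theta> j = 0" using Qx(1) by (auto simp: Rn_def y_def)
      then show ?thesis unfolding sumj by simp
    qed
  qed
  moreover have "(\<Sum>i<N. (ts ! Suc i - ts ! i) *\<^sub>R y (ts ! i)) \<in> Qstar A m n b"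
    unfolding Qstar_def
  proof (rule convex_sum)
    show "(\<Sum>i<N. ts ! Suc i - ts ! i) = 1"
      using sum_lessThan_telescope[of "(!) ts" N] ends by simp
    show "ts ! Suc i - ts ! i \<ge> 0" if "i \<in> {..<N}" for i
      using mono[of i "Suc i"] that by simp
    show "y (ts ! i) \<in> convex hull (Qpoly A m n b \<inter> int_points n)" for i
      by (rule hull_inc[OF yQ])
  qed (auto simp: convex_convex_hull)
  ultimately show ?thesis by simp
qed

section \<open>Walks in the digraph\<close>

text \<open>Arcs count with multiplicity, because walks may repeat them. For circuits,
  \<open>dir_sum_eq_sum\<close> leads back to sums over sets of arcs.\<close>

definition dir_sum :: "bool \<Rightarrow> (nat \<Rightarrow> real) \<Rightarrow> arc list \<Rightarrow> real" where
  "dir_sum d f as = (\<Sum>a\<leftarrow>as. case a of Arc e i \<Rightarrow> if e = d then f i else 0)"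

lemma dir_sum_simps [simp]:
  "dir_sum d f [] = 0"
  "dir_sum d f (Arc e i # as) = (if e = d then f i else 0) + dir_sum d f as"
  by (simp_all add: dir_sum_def)

lemma dir_sum_eq_sum:
  assumes "distinct as"
  shows "dir_sum d f as = (\<Sum>i\<in>{i. Arc d i \<in> set as}. f i)"
  using assms
proof (induction as)
  case (Cons a as)
  obtain e i where a: "a = Arc e i" by (cases a)
  have fin: "finite {i. Arc d i \<in> set as}"
    using finite_vimageI[OF finite_set, of "Arc d" as] by (simp add: inj_def vimage_def)
  show ?case
  proof (cases "e = d")
    case True
    then have "{j. Arc d j \<in> set (a # as)} = insert i {j. Arc d j \<in> set as}"
      using a by auto
    then show ?thesis using Cons True fin a by simp
  next
    case False
    then show ?thesis using Cons a by simp
  qed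
qed simp

lemma dir_sum_mono:
  assumes "\<And>i. Arc d i \<in> set as \<Longrightarrow> f i \<le> g i"
  shows "dir_sum d f as \<le> dir_sum d g as"
  using assms
proof (induction as)
  case (Cons a as)
  then show ?case by (cases a) (auto intro!: add_mono)
qed simp

lemma dir_sum_cmult: "dir_sum d (\<lambda>i. c * f i) as = c * dir_sum d f as"
proof (induction as)
  case (Cons a as)
  then show ?case by (cases a) (auto simp: algebra_simps)
qed simp

text \<open>With \<open>f\<close> the tail map, this cuts a walk at a repeated node:
  \<open>a # ys\<close> is then a closed detour that can be taken out.\<close>

lemma not_distinct_map_decomp:
  assumes "\<not> distinct (map f as)"
  obtains xs a ys b zs where "as = xs @ (a # ys) @ (b # zs)" "f a = f b"
proof -
  obtain i j where ij: "i < j" "j < length as" "f (as ! i) = f (as ! j)"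
    using assms by (auto simp: distinct_conv_nth) (metis nat_neq_iff)
  define us where "us = take j as"
  define vs where "vs = as ! j # drop (Suc j) as"
  have "us = take i us @ us ! i # drop (Suc i) us"
    using ij by (intro id_take_nth_drop) (simp add: us_def)
  then have "us @ vs = (take i us @ us ! i # drop (Suc i) us) @ vs"
    by (rule arg_cong)
  moreover have "as = us @ vs"
    unfolding us_def vs_def using ij by (intro id_take_nth_drop) simp
  ultimately have "as = take i us @ (us ! i # drop (Suc i) us) @ vs" by simp
  then have "as = take i us @ (us ! i # drop (Suc i) us) @ (as ! j # drop (Suc j) as)"
    by (simp only: vs_def)
  moreover have "f (us ! i) = f (as ! j)" using ij by (simp add: us_def)
  ultimately show thesis by (rule that)
qed

locale circular_arcs =
  fixes m n :: nat and l k :: "nat \<Rightarrow> nat"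
  assumes n_pos: "n > 0" and k_le: "i \<in> {1..m} \<Longrightarrow> k i \<le> n"
begin

abbreviation path_len :: "arc list \<Rightarrow> int" where
  "path_len as \<equiv> sum_list (map (arc_len m k) as)"

text \<open>Scaled by \<alpha>, this is the right-hand side of the constraint attached to an arc:
  \<alpha> for a row, 0 for the nonnegativity constraint of a short arc.\<close>

definition row_ind :: "nat \<Rightarrow> real" where
  "row_ind i = (if i \<le> m then 1 else 0)"

text \<open>The matching left-hand side: row \<open>i\<close> evaluated at \<open>x\<close>, or the
  single coordinate \<open>x (i - m)\<close> for a short arc.\<close>

definition jump_sum :: "(nat \<Rightarrow> real) \<Rightarrow> nat \<Rightarrow> real" where
  "jump_sum x i = (\<Sum>j | j \<in> {1..n} \<and> jumps m n l k i j. x j)"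

text \<open>Walks are followed in the universal cover \<open>\<int>\<close> of the cyclic node set: the integer position moves by
  the arc lengths, so a walk is closed iff \<open>n\<close> divides its total length.\<close>

fun walk :: "int \<Rightarrow> arc list \<Rightarrow> bool" where
  "walk z [] \<longleftrightarrow> True"
| "walk z (a # as) \<longleftrightarrow>
     a \<in> arc_set m n \<and> tail m n l k a = z mod int n \<and> walk (z + arc_len m k a) as"

lemma walk_append: "walk z (as @ bs) \<longleftrightarrow> walk z as \<and> walk (z + path_len as) bs"
  by (induction as arbitrary: z) (auto simp: add.assoc)

lemma walk_cong:
  assumes "z mod int n = z' mod int n"
  shows "walk z as \<longleftrightarrow> walk z' as"
  using assms
proof (induction as arbitrary: z z')
  case (Cons a as)
  then have "(z + arc_len m k a) mod int n = (z' + arc_len m k a) mod int n"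
    by (metis mod_add_left_eq)
  from Cons.IH[OF this] Cons.prems show ?case by (simp only: walk.simps)
qed simp

text \<open>This justifies checking only tails in \<open>walk\<close>: adding the length to a lift
  of the tail yields a lift of the head.\<close>

lemma head_eq:
  assumes "tail m n l k a = z mod int n"
  shows "head m n l k a = (z + arc_len m k a) mod int n"
proof -
  obtain d i where a: "a = Arc d i" by (cases a)
  define u where "u = (if i \<le> m then int (l i) - 1 else int (i - m) - 1)"
  define s where "s = (if i \<le> m then int (k i) else 1)"
  have ft: "fw_tail m n l k i = u mod int n"
    by (simp add: fw_tail_def u_def)
  have fh: "fw_head m n l k i = (u + s) mod int n"
    by (simp add: fw_head_def u_def s_def algebra_simps)
  have len: "arc_len m k a = (if d then s else - s)" by (simp add: a s_def)
  show ?thesis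
  proof (cases d)
    case True
    then show ?thesis using assms ft fh len a by (metis head.simps mod_add_left_eq tail.simps)
  next
    case False
    then have "(u + s) mod int n = z mod int n" using assms fh a by simp
    then have "(u + s - s) mod int n = (z - s) mod int n" by (metis mod_diff_left_eq)
    then show ?thesis using False ft len a by simp
  qed
qed

lemma jump_sum_row:
  assumes "i \<in> {1..m}"
  shows "jump_sum x i = (\<Sum>j\<in>cinterval n (l i) (k i). x j)"
proof -
  have "{j. j \<in> {1..n} \<and> jumps m n l k i j} = cinterval n (l i) (k i)"
    using assms by (auto simp: jumps_def cinterval_def)
  then show ?thesis by (simp add: jump_sum_def)
qed

lemma jump_sum_fwd:
  assumes "prefix_lift n x c X" "Arc d i \<in> arc_set m n" "fw_tail m n l k i = z mod int n"
  shows "jump_sum x i = X (z + arc_len m k (Arc True i)) - X z"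
proof (cases "i \<le> m")
  case True
  with assms(2) have i: "i \<in> {1..m}" by (auto simp: arc_set_def)
  have "jump_sum x i = X (int (l i) - 1 + int (k i)) - X (int (l i) - 1)"
    unfolding jump_sum_row[OF i] by (rule sum_cinterval[OF assms(1) n_pos k_le[OF i]])
  also have "\<dots> = X (z + int (k i)) - X z"
    using assms(3) True by (intro prefix_lift_cong_diff[OF assms(1)]) (simp add: fw_tail_def)
  finally show ?thesis using True by simp
next
  case False
  with assms(2) have i: "i - m \<in> {1..n}" by (auto simp: arc_set_def)
  have "{j. j \<in> {1..n} \<and> jumps m n l k i j} = {i - m}"
    using False i by (auto simp: jumps_def)
  then have "jump_sum x i = X (int (i - m) - 1 + 1) - X (int (i - m) - 1)"
    using assms(1) i by (simp add: jump_sum_def prefix_lift_def)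
  also have "\<dots> = X (z + 1) - X z"
    using assms(3) False by (intro prefix_lift_cong_diff[OF assms(1)]) (simp add: fw_tail_def)
  finally show ?thesis using False by simp
qed

lemma jump_sum_rev:
  assumes "prefix_lift n x c X" "Arc d i \<in> arc_set m n" "fw_head m n l k i = z mod int n"
  shows "jump_sum x i = X z - X (z + arc_len m k (Arc False i))"
proof -
  have "head m n l k (Arc False i) = (z + arc_len m k (Arc False i)) mod int n"
    by (rule head_eq) (simp only: tail.simps if_False assms(3))
  then have "fw_tail m n l k i = (z + arc_len m k (Arc False i)) mod int n"
    by (simp only: head.simps if_False)
  from jump_sum_fwd[OF assms(1,2) this] show ?thesis by simp
qed

lemma jump_sum_nonneg:
  "(\<And>j. j \<in> {1..n} \<Longrightarrow> x j \<ge> 0) \<Longrightarrow> jump_sum x i \<ge> 0"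
  unfolding jump_sum_def by (rule sum_nonneg) simp

text \<open>A forward arc raises \<open>X\<close> by its jump sum and a reverse arc lowers it by its
  jump sum, so the differences telescope.\<close>

lemma walk_jump_sums:
  assumes "prefix_lift n x c X" "walk z as"
  shows "dir_sum True (jump_sum x) as - dir_sum False (jump_sum x) as = X (z + path_len as) - X z"
  using assms(2)
proof (induction as arbitrary: z)
  case (Cons a as)
  obtain d i where a: "a = Arc d i" by (cases a)
  have IH: "dir_sum True (jump_sum x) as - dir_sum False (jump_sum x) as
      = X (z + path_len (a # as)) - X (z + arc_len m k a)"
    using Cons.IH[of "z + arc_len m k a"] Cons.prems by (simp add: add.assoc)
  show ?case
  proof (cases d)
    case True
    then show ?thesis
      using IH jump_sum_fwd[OF assms(1), of d i z] Cons.prems by (simp add: a)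
  next
    case False
    then show ?thesis
      using IH jump_sum_rev[OF assms(1), of d i z] Cons.prems by (simp add: a)
  qed
qed simp

lemma closed_walk_jump_sums:
  assumes "prefix_lift n x c X" "walk z as" "path_len as = int n * p"
  shows "dir_sum True (jump_sum x) as - dir_sum False (jump_sum x) as = c * real_of_int p"
  using walk_jump_sums[OF assms(1,2)] prefix_lift_shift[OF assms(1), of z p] assms(3) by simp

text \<open>Adds up the row inequalities over the row arcs and the nonnegativity constraints over
  the short arcs.\<close>

lemma row_sum_le_jump_sum:
  fixes \<alpha> :: real
  assumes nonneg: "\<And>j. j \<in> {1..n} \<Longrightarrow> x j \<ge> 0"
    and rows: "\<And>i. i \<in> {1..m} \<Longrightarrow> jump_sum x i \<ge> \<alpha>"
    and walk: "walk z as"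
  shows "\<alpha> * dir_sum d row_ind as \<le> dir_sum d (jump_sum x) as"
proof -
  have sub: "set as \<subseteq> arc_set m n"
    using walk by (induction as arbitrary: z) auto
  have "\<alpha> * row_ind i \<le> jump_sum x i" if "Arc d i \<in> set as" for i
  proof (cases "i \<le> m")
    case True
    then have "i \<in> {1..m}" using that sub by (auto simp: arc_set_def)
    then show ?thesis using rows by (simp add: row_ind_def)
  next
    case False
    then show ?thesis using jump_sum_nonneg nonneg by (simp add: row_ind_def)
  qed
  then show ?thesis
    unfolding dir_sum_cmult[symmetric] by (rule dir_sum_mono)
qed

section \<open>Circuits as closed walks\<close>

lemma circuit_walk:
  assumes "is_circuit m n l k cs"
  shows "walk (tail m n l k (hd cs)) cs" "path_len cs = int n * winding m n k cs" "distinct cs"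
proof -
  let ?N = "length cs"
  define z where "z = tail m n l k (hd cs)"
  have ne: "cs \<noteq> []" and sub: "set cs \<subseteq> arc_set m n"
    and link: "\<And>t. t < ?N \<Longrightarrow> head m n l k (cs ! t) = tail m n l k (cs ! ((t + 1) mod ?N))"
    and dist: "distinct (map (tail m n l k) cs)"
    using assms by (auto simp: is_circuit_def)
  have zmod: "z mod int n = z"
    unfolding z_def by (cases "hd cs") (simp add: fw_tail_def fw_head_def)
  \<comment> \<open>The case \<open>t = length cs\<close> wraps around to the first arc. It shows
    that the total length is a multiple of n, so that the \<open>div\<close> in
    \<open>winding\<close> is exact.\<close>
  have pos: "tail m n l k (cs ! (t mod ?N)) = (z + path_len (take t cs)) mod int n" if "t \<le> ?N" for t
    using that
  proof (induction t)
    case 0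
    then show ?case using ne zmod by (simp add: z_def hd_conv_nth)
  next
    case (Suc t)
    then have "tail m n l k (cs ! t) = (z + path_len (take t cs)) mod int n" by simp
    from head_eq[OF this] link[of t] Suc.prems show ?case
      by (simp add: take_Suc_conv_app_nth add.assoc)
  qed
  have "walk (z + path_len (take t cs)) (drop t cs)" if "t \<le> ?N" for t
    using that
  proof (induction t rule: inc_induct)
    case base
    then show ?case by simp
  next
    case (step t)
    have "drop t cs = cs ! t # drop (Suc t) cs" using step by (simp add: Cons_nth_drop_Suc)
    moreover have "tail m n l k (cs ! t) = (z + path_len (take t cs)) mod int n"
      using pos[of t] step by simp
    moreover have "cs ! t \<in> arc_set m n" using sub step by (meson nth_mem subsetD)
    ultimately show ?case
      using step by (simp add: take_Suc_conv_app_nth add.assoc)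
  qed
  from this[of 0] show "walk (tail m n l k (hd cs)) cs" by (simp add: z_def)
  show d: "distinct cs" using dist by (simp add: distinct_map)
  have "z = (z + path_len cs) mod int n"
    using pos[of ?N] ne by (simp add: z_def hd_conv_nth)
  then have "z mod int n = (z + path_len cs) mod int n" using zmod by simp
  then have "int n dvd path_len cs" by (simp add: mod_eq_dvd_iff)
  moreover have "path_len cs = (\<Sum>a\<in>set cs. arc_len m k a)"
    using d by (simp add: sum_list_distinct_conv_sum_set)
  ultimately show "path_len cs = int n * winding m n k cs" by (simp add: winding_def)
qed

text \<open>\<open>walk\<close> does not link the last arc to the first; divisibility of the length
  by n supplies that link.\<close>

lemma walk_circuit:
  assumes "walk z cs" "int n dvd path_len cs" "cs \<noteq> []" "distinct (map (tail m n l k) cs)"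
  shows "is_circuit m n l k cs"
proof -
  let ?N = "length cs"
  have nth: "cs ! t \<in> arc_set m n \<and> tail m n l k (cs ! t) = (z + path_len (take t cs)) mod int n"
    if "t < ?N" for t
  proof -
    have "walk z (take t cs @ cs ! t # drop (Suc t) cs)"
      using that assms(1) by (simp add: id_take_nth_drop[symmetric])
    then show ?thesis by (simp add: walk_append)
  qed
  have "head m n l k (cs ! t) = tail m n l k (cs ! ((t + 1) mod ?N))" if "t < ?N" for t
  proof -
    have hd: "head m n l k (cs ! t) = (z + path_len (take (Suc t) cs)) mod int n"
      using head_eq nth[OF that] that by (simp add: take_Suc_conv_app_nth add.assoc)
    show ?thesis
    proof (cases "Suc t < ?N")
      case True
      then show ?thesis using hd nth by simp
    next
      case False
      then have "Suc t = ?N" using that by simp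
      moreover have "(z + path_len cs) mod int n = z mod int n"
        using assms(2) by (metis add.right_neutral dvd_imp_mod_0 mod_add_right_eq)
      ultimately show ?thesis using hd nth[of 0] assms(3) by simp
    qed
  qed
  moreover have "set cs \<subseteq> arc_set m n" using nth by (auto simp: in_set_conv_nth)
  ultimately show ?thesis using assms(3,4) by (auto simp: is_circuit_def)
qed

lemma circuit_row_count:
  assumes "is_circuit m n l k cs"
  shows "real (card {i\<in>{1..m}. Arc d i \<in> set cs}) = dir_sum d row_ind cs"
proof -
  have sub: "set cs \<subseteq> arc_set m n" using assms by (simp add: is_circuit_def)
  have fin: "finite {i. Arc d i \<in> set cs}"
    using finite_vimageI[OF finite_set, of "Arc d" cs] by (simp add: inj_def vimage_def)
  have "dir_sum d row_ind cs = (\<Sum>i\<in>{i. Arc d i \<in> set cs}. row_ind i)"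
    by (rule dir_sum_eq_sum[OF circuit_walk(3)[OF assms]])
  also have "\<dots> = (\<Sum>i\<in>{i\<in>{1..m}. Arc d i \<in> set cs}. 1)"
    using sub fin
    by (intro sum.mono_neutral_cong_right) (auto simp: row_ind_def arc_set_def)
  finally show ?thesis by simp
qed

lemma circuit_t_val:
  assumes "is_circuit m n l k cs"
  shows "real_of_int (t_val m cs (\<lambda>_. \<alpha>)) = \<alpha> * (dir_sum True row_ind cs - dir_sum False row_ind cs)"
  using circuit_row_count[OF assms]
  by (simp add: t_val_def right_diff_distrib)

text \<open>Double counting of the pairs of a reverse arc and an index it jumps over.\<close>

lemma circuit_p_minus:
  assumes "is_circuit m n l k cs"
  shows "(\<Sum>j=1..n. real (p_minus m n l k cs j) * x j) = dir_sum False (jump_sum x) cs"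
proof -
  let ?I = "{i. Arc False i \<in> set cs}"
  have fin: "finite ?I"
    using finite_vimageI[OF finite_set, of "Arc False" cs] by (simp add: inj_def vimage_def)
  have "(\<Sum>j=1..n. real (p_minus m n l k cs j) * x j)
      = (\<Sum>j=1..n. \<Sum>i\<in>?I. if jumps m n l k i j then x j else 0)"
  proof (intro sum.cong refl)
    fix j
    have "(\<Sum>i\<in>?I. if jumps m n l k i j then x j else 0)
        = (\<Sum>i\<in>{i. Arc False i \<in> set cs \<and> jumps m n l k i j}. x j)"
      using fin by (intro sum.mono_neutral_cong_right) auto
    then show "real (p_minus m n l k cs j) * x j
        = (\<Sum>i\<in>?I. if jumps m n l k i j then x j else 0)"
      by (simp add: p_minus_def)
  qed
  also have "\<dots> = (\<Sum>i\<in>?I. \<Sum>j=1..n. if jumps m n l k i j then x j else 0)"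
    by (rule sum.swap)
  also have "\<dots> = (\<Sum>i\<in>?I. jump_sum x i)"
    unfolding jump_sum_def by (intro sum.cong refl sum.mono_neutral_cong_right) auto
  finally show ?thesis using dir_sum_eq_sum[OF circuit_walk(3)[OF assms]] by simp
qed

lemma gamma_ineq_iff:
  fixes \<alpha> \<beta> r :: int and x :: "nat \<Rightarrow> real"
  assumes "is_circuit m n l k cs"
    and "p = winding m n k cs" "t = t_val m cs (\<lambda>_. \<alpha>)" "\<beta> = t div p" "r = t - \<beta> * p"
  shows "x \<in> gamma_ineq m n l k cs (\<lambda>_. \<alpha>) \<longleftrightarrow>
    dir_sum False (jump_sum x) cs + r * (\<Sum>j=1..n. x j) \<ge> r * (\<beta> + 1) + \<alpha> * dir_sum False row_ind cs"
proof -
  have "(\<Sum>j=1..n. real_of_int (int (p_minus m n l k cs j) + r) * x j)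
     = dir_sum False (jump_sum x) cs + r * (\<Sum>j=1..n. x j)"
    unfolding circuit_p_minus[OF assms(1), symmetric]
    by (simp add: algebra_simps sum.distrib sum_distrib_left)
  then show ?thesis
    using circuit_row_count[OF assms(1)] assms(2-)
    by (simp add: gamma_ineq_def Let_def mult.commute)
qed

text \<open>A disjunctive argument on the integer \<open>s\<close>. If
  \<open>s \<ge> \<beta> + 1\<close>, the constraints along the reverse arcs suffice. If
  \<open>s \<le> \<beta>\<close>, the reverse jump sums are expressed by the forward ones, and the
  slack left over is at least (p - r)(\<beta> - s).\<close>

lemma integral_point_gamma_ineq:
  fixes s \<alpha> :: int
  assumes circuit: "is_circuit m n l k cs" and p: "winding m n k cs > 0"
    and nonneg: "\<And>j. j \<in> {1..n} \<Longrightarrow> x j \<ge> 0"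
    and rows: "\<And>i. i \<in> {1..m} \<Longrightarrow> jump_sum x i \<ge> \<alpha>"
    and s: "(\<Sum>j=1..n. x j) = s"
  shows "x \<in> gamma_ineq m n l k cs (\<lambda>_. \<alpha>)"
proof -
  define p where "p = winding m n k cs"
  define t where "t = t_val m cs (\<lambda>_. \<alpha>)"
  define \<beta> where "\<beta> = t div p"
  define r where "r = t - \<beta> * p"
  have r: "0 \<le> r" "r < p"
    using p by (simp_all add: r_def \<beta>_def p_def minus_div_mult_eq_mod)
  let ?F = "dir_sum True (jump_sum x) cs" and ?R = "dir_sum False (jump_sum x) cs"
  let ?N = "\<lambda>d. dir_sum d row_ind cs"
  obtain X where X: "prefix_lift n x s X" using prefix_lift_exists[OF n_pos, of x] s by auto
  have FR: "?F - ?R = s * p"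
    using closed_walk_jump_sums[OF X circuit_walk(1,2)[OF circuit]] by (simp add: p_def)
  have le: "\<alpha> * ?N d \<le> dir_sum d (jump_sum x) cs" for d
    by (rule row_sum_le_jump_sum[OF nonneg rows circuit_walk(1)[OF circuit]])
  have t: "real_of_int t = \<alpha> * (?N True - ?N False)"
    unfolding t_def by (rule circuit_t_val[OF circuit])
  have "?R + r * s \<ge> r * (\<beta> + 1) + \<alpha> * ?N False"
  proof (cases "s \<ge> \<beta> + 1")
    case True
    then have "r * (\<beta> + 1) \<le> r * s" using r by (simp add: mult_left_mono)
    then have "real_of_int (r * (\<beta> + 1)) \<le> real_of_int (r * s)" by (simp only: of_int_le_iff)
    then show ?thesis using le[of False] by linarith
  next
    case False
    then have "(p - r) * s \<le> (p - r) * \<beta>" using r by (simp add: mult_left_mono)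
    then have "r * (\<beta> + 1) \<le> t - s * p + r * s" by (simp add: r_def algebra_simps)
    then have "real_of_int (r * (\<beta> + 1)) \<le> real_of_int (t - s * p + r * s)"
      by (simp only: of_int_le_iff)
    then show ?thesis using FR le[of True] t by (simp add: right_diff_distrib)
  qed
  then show ?thesis
    unfolding gamma_ineq_iff[OF circuit p_def t_def \<beta>_def r_def] s by simp
qed

end

section \<open>Splitting a fractional point\<close>

text \<open>Here \<open>\<beta> = \<lfloor>1x\<rfloor>\<close> and \<open>\<mu> = \<beta> + 1 - 1x\<close>; the goal is a part \<open>u\<close> of \<open>x\<close> such that \<open>u / \<mu>\<close> and
  \<open>(x - u) / (1 - \<mu>)\<close> are covers of coordinate sum \<open>\<beta>\<close> and \<open>\<beta> + 1\<close>. In terms of the prefix sums of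
  \<open>u\<close> all requirements are difference constraints along the arcs, with right-hand side \<open>gain\<close>. The term
  \<open>\<mu>\<beta>/n\<close> per unit length makes the potential periodic.\<close>

locale covering_point = circular_arcs +
  fixes x :: "nat \<Rightarrow> real" and X :: "int \<Rightarrow> real" and \<alpha> \<beta> :: int and \<mu> :: real
  assumes lift: "prefix_lift n x (real_of_int \<beta> + 1 - \<mu>) X"
    and nonneg: "j \<in> {1..n} \<Longrightarrow> x j \<ge> 0"
    and rows: "i \<in> {1..m} \<Longrightarrow> jump_sum x i \<ge> real_of_int \<alpha>"
    and alpha_pos: "\<alpha> > 0" and beta_nonneg: "\<beta> \<ge> 0" and mu: "0 \<le> \<mu>" "\<mu> \<le> 1"
begin

section \<open>Gains of closed walks\<close>

definition \<kappa> :: real where "\<kappa> = \<mu> * \<beta> / n"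

text \<open>Forward arcs carry the lower bounds on the jump sums of \<open>u\<close>, needed for
  \<open>u / \<mu>\<close>; reverse arcs carry the upper bounds, needed for
  \<open>(x - u) / (1 - \<mu>)\<close>.\<close>

fun gain :: "arc \<Rightarrow> real" where
  "gain (Arc d i) = (if d then \<mu> * \<alpha> * row_ind i else (1 - \<mu>) * \<alpha> * row_ind i - jump_sum x i)
     - \<kappa> * arc_len m k (Arc d i)"

abbreviation walk_gain :: "arc list \<Rightarrow> real" where
  "walk_gain as \<equiv> sum_list (map gain as)"

fun is_row :: "arc \<Rightarrow> bool" where "is_row (Arc d i) \<longleftrightarrow> i \<le> m"
fun is_fwd :: "arc \<Rightarrow> bool" where "is_fwd (Arc d i) \<longleftrightarrow> d"

lemma walk_gain_eq:
  "walk_gain as = \<mu> * \<alpha> * dir_sum True row_ind as + (1 - \<mu>) * \<alpha> * dir_sum False row_ind as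
     - dir_sum False (jump_sum x) as - \<kappa> * path_len as"
proof (induction as)
  case (Cons a as)
  obtain d i where "a = Arc d i" by (cases a)
  with Cons show ?case by (cases d) (simp_all add: algebra_simps)
qed simp

text \<open>The \<kappa>-terms add up to \<mu>\<beta>p. For a circuit with
  \<open>\<beta> = t div p\<close>, a gain of at most 0 is the \<Gamma>-inequality at coordinate sum
  \<beta> + 1 - \<mu>: its two r-terms differ by \<mu>r.\<close>

lemma closed_walk_gain:
  assumes "walk z as" "path_len as = int n * p"
    and "r = \<alpha> * (dir_sum True row_ind as - dir_sum False row_ind as) - p * \<beta>"
  shows "walk_gain as = \<mu> * r - (dir_sum False (jump_sum x) as - \<alpha> * dir_sum False row_ind as)"
proof -
  have "\<kappa> * path_len as = \<mu> * \<beta> * p" using n_pos assms(2) by (simp add: \<kappa>_def)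
  then show ?thesis unfolding walk_gain_eq assms(3) by (simp add: algebra_simps)
qed

text \<open>For \<open>r \<le> 0\<close> the constraints along the reverse arcs suffice. For
  \<open>r \<ge> p\<close>, trading reverse jump sums for forward ones bounds the gain by (1 -
  \<mu>)(p - r). Only 0 < r < p is left to the \<Gamma>-inequalities.\<close>

lemma closed_walk_gain_nonpos:
  assumes "walk z as" "path_len as = int n * p"
    and r: "r = \<alpha> * (dir_sum True row_ind as - dir_sum False row_ind as) - p * \<beta>"
    and "r \<le> 0 \<or> r \<ge> p"
  shows "walk_gain as \<le> 0"
  using assms(4)
proof
  assume "r \<le> 0"
  then have "\<mu> * r \<le> 0" using mu by (simp add: mult_nonneg_nonpos)
  then show ?thesis
    using closed_walk_gain[OF assms(1-3)] row_sum_le_jump_sum[OF nonneg rows, OF _ _ assms(1), of False] by linarith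
next
  assume "r \<ge> p"
  then have "(1 - \<mu>) * (p - r) \<le> 0" using mu by (simp add: mult_nonneg_nonpos)
  moreover have "dir_sum True (jump_sum x) as - dir_sum False (jump_sum x) as = (real_of_int \<beta> + 1 - \<mu>) * p"
    by (rule closed_walk_jump_sums[OF lift assms(1,2)])
  moreover have "\<alpha> * dir_sum True row_ind as \<le> dir_sum True (jump_sum x) as"
    by (rule row_sum_le_jump_sum[OF nonneg rows, OF _ _ assms(1)])
  ultimately show ?thesis
    using closed_walk_gain[OF assms(1-3)] r by (simp add: algebra_simps)
qed

section \<open>Walks of short arcs and the exchange of row arcs\<close>

lemma X_mono: "mono X"
  by (rule prefix_lift_mono[OF lift n_pos nonneg])

lemma gain_fwd_row:
  "i \<le> m \<Longrightarrow> gain (Arc True i) = \<mu> * \<alpha> - \<kappa> * k i"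
  by (simp add: row_ind_def)

lemma gain_rev_row:
  assumes "walk z [Arc False i]" "i \<le> m"
  shows "gain (Arc False i) = (1 - \<mu>) * \<alpha> - (X z - X (z - int (k i))) + \<kappa> * k i"
  using assms jump_sum_rev[OF lift, of False i z] by (simp add: row_ind_def)

lemma gain_fwd_short:
  "\<not> i \<le> m \<Longrightarrow> gain (Arc True i) = - \<kappa>"
  by (simp add: row_ind_def)

lemma gain_rev_short:
  assumes "walk z [Arc False i]" "\<not> i \<le> m"
  shows "gain (Arc False i) = \<kappa> - (X z - X (z - 1))"
  using assms jump_sum_rev[OF lift, of False i z] by (simp add: row_ind_def)

text \<open>The \<kappa>-part depends on the length only. Apart from it, forward short arcs lose
  nothing and a reverse one loses the drop of \<open>X\<close> along it, so the loss is at least the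
  net drop.\<close>

lemma short_walk_gain_le:
  assumes "walk z as" "\<forall>a\<in>set as. \<not> is_row a"
  shows "walk_gain as \<le> - \<kappa> * path_len as - max 0 (X z - X (z + path_len as))"
  using assms
proof (induction as arbitrary: z)
  case (Cons a as)
  obtain d i where a: "a = Arc d i" by (cases a)
  have i: "\<not> i \<le> m" using Cons.prems a by simp
  let ?z = "z + arc_len m k a"
  have IH: "walk_gain as \<le> - \<kappa> * path_len as - max 0 (X ?z - X (?z + path_len as))"
    using Cons by simp
  show ?case
  proof (cases d)
    case True
    then have "gain a = - \<kappa>" "arc_len m k a = 1" using gain_fwd_short[OF i] i a by simp_all
    moreover have "X z \<le> X (z + 1)" using X_mono by (simp add: monoD)
    ultimately show ?thesis using IH by (simp add: algebra_simps)
  next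
    case False
    then have "gain a = \<kappa> - (X z - X (z - 1))" "arc_len m k a = -1"
      using gain_rev_short[of z i] i a Cons.prems by simp_all
    moreover have "X (z - 1) \<le> X z" using X_mono by (simp add: monoD)
    ultimately show ?thesis using IH by (simp add: algebra_simps)
  qed
qed simp

text \<open>The short arc between \<open>z\<close> and \<open>z + 1\<close>, in either direction;
  the index it jumps over is the representative of \<open>z + 1\<close> in
  \<open>{1..n}\<close>.\<close>

definition short_arc :: "bool \<Rightarrow> int \<Rightarrow> arc" where
  "short_arc d z = Arc d (m + Suc (nat (z mod int n)))"

lemma short_arc_walk:
  "walk z [short_arc True z]" "walk (z + 1) [short_arc False z]"
proof -
  have nat: "nat (z mod int n) < n" using n_pos by (simp add: nat_less_iff)
  have "int (Suc (nat (z mod int n))) = z mod int n + 1" using n_pos by simp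
  then have "int (Suc (nat (z mod int n))) mod int n = (z + 1) mod int n"
    by (metis mod_add_left_eq)
  then show "walk z [short_arc True z]" "walk (z + 1) [short_arc False z]"
    using nat n_pos by (auto simp: short_arc_def arc_set_def fw_tail_def fw_head_def)
qed

text \<open>Walking straight in one direction attains the bound of
  \<open>short_walk_gain_le\<close>.\<close>

lemma short_walk_exists:
  "\<exists>as. walk z as \<and> path_len as = d \<and> (\<forall>a\<in>set as. \<not> is_row a)
     \<and> walk_gain as = - \<kappa> * d - max 0 (X z - X (z + d))"
proof (cases "d \<ge> 0")
  case True
  have "\<exists>as. walk z as \<and> path_len as = int e \<and> (\<forall>a\<in>set as. \<not> is_row a) \<and> walk_gain as = - \<kappa> * e" for e
  proof (induction e)
    case (Suc e)
    then obtain as where as: "walk z as" "path_len as = int e" "\<forall>a\<in>set as. \<not> is_row a"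
      "walk_gain as = - \<kappa> * e" by auto
    let ?a = "short_arc True (z + int e)"
    have "gain ?a = - \<kappa>" unfolding short_arc_def by (rule gain_fwd_short) simp
    then have "walk_gain (as @ [?a]) = - \<kappa> * Suc e" using as by (simp add: algebra_simps)
    moreover have "walk z (as @ [?a])" using as short_arc_walk(1) by (simp add: walk_append)
    moreover have "path_len (as @ [?a]) = int (Suc e)" using as by (simp add: short_arc_def)
    moreover have "\<forall>a\<in>set (as @ [?a]). \<not> is_row a" using as by (auto simp: short_arc_def)
    ultimately show ?case by blast
  qed (auto intro!: exI[of _ "[]"])
  from this[of "nat d"] obtain as where "walk z as" "path_len as = int (nat d)"
    "\<forall>a\<in>set as. \<not> is_row a" "walk_gain as = - \<kappa> * nat d"
    by blast
  moreover have "X z \<le> X (z + d)" using True X_mono by (simp add: monoD)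
  ultimately show ?thesis using True by (intro exI[of _ as]) simp
next
  case False
  have "\<exists>as. walk z as \<and> path_len as = - int e \<and> (\<forall>a\<in>set as. \<not> is_row a)
      \<and> walk_gain as = \<kappa> * e - (X z - X (z - int e))" for e
  proof (induction e)
    case (Suc e)
    then obtain as where as: "walk z as" "path_len as = - int e" "\<forall>a\<in>set as. \<not> is_row a"
      "walk_gain as = \<kappa> * e - (X z - X (z - int e))" by auto
    let ?a = "short_arc False (z - int e - 1)"
    have w: "walk (z - int e) [?a]" using short_arc_walk(2)[of "z - int e - 1"] by simp
    then have "gain ?a = \<kappa> - (X (z - int e) - X (z - int e - 1))"
      unfolding short_arc_def by (intro gain_rev_short) auto
    then have "walk_gain (as @ [?a]) = \<kappa> * Suc e - (X z - X (z - int (Suc e)))"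
      using as by (simp add: algebra_simps)
    moreover have "walk z (as @ [?a])" using as w by (simp add: walk_append)
    moreover have "path_len (as @ [?a]) = - int (Suc e)" using as by (simp add: short_arc_def)
    moreover have "\<forall>a\<in>set (as @ [?a]). \<not> is_row a" using as by (auto simp: short_arc_def)
    ultimately show ?case by blast
  qed (auto intro!: exI[of _ "[]"])
  from this[of "nat (- d)"] obtain as where "walk z as" "path_len as = - int (nat (- d))"
    "\<forall>a\<in>set as. \<not> is_row a" "walk_gain as = \<kappa> * nat (- d) - (X z - X (z - int (nat (- d))))"
    by blast
  moreover have "X (z + d) \<le> X z" using False X_mono by (simp add: monoD)
  ultimately show ?thesis using False by (intro exI[of _ as]) simp
qed

text \<open>A reverse row arc from \<open>w'\<close> to \<open>w\<close>, short arcs from \<open>w\<close> to \<open>a\<close> and a forward row arc from \<open>a\<close> to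
  \<open>b\<close> lose at least \<open>max (X w' - X w) (X w' - X a) - \<alpha>\<close>, whereas the short arcs from \<open>w'\<close>
  to \<open>b\<close> lose only \<open>max 0 (X w' - X b)\<close>; this is where the equal right-hand sides are used.\<close>

lemma replace_rev_fwd:
  assumes w: "walk z (Arc False i # ss @ [Arc True i'])"
    and rows_ii': "i \<le> m" "i' \<le> m" and short: "\<forall>a\<in>set ss. \<not> is_row a"
  shows "\<exists>as. walk z as \<and> path_len as = path_len (Arc False i # ss @ [Arc True i'])
    \<and> (\<forall>a\<in>set as. \<not> is_row a) \<and> walk_gain (Arc False i # ss @ [Arc True i']) \<le> walk_gain as"
proof -
  define w where "w = z - int (k i)"
  define a where "a = w + path_len ss"
  define b where "b = a + int (k i')"
  let ?old = "Arc False i # ss @ [Arc True i']"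
  have parts: "walk z [Arc False i]" "walk w ss" "walk a [Arc True i']"
    using assms w_def a_def by (auto simp: walk_append)
  have i: "i \<in> {1..m}" "i' \<in> {1..m}" using w rows_ii' by (auto simp: arc_set_def walk_append)
  have "jump_sum x i = X z - X w"
    using jump_sum_rev[OF lift, of False i z] parts(1) rows_ii' by (simp add: w_def)
  moreover have "jump_sum x i' = X b - X a"
    using jump_sum_fwd[OF lift, of True i' a] parts(3) rows_ii' by (simp add: b_def)
  ultimately have \<alpha>: "X z - X w \<ge> \<alpha>" "X b - X a \<ge> \<alpha>" using rows i by metis+
  have len: "path_len ?old = b - z" using rows_ii' by (simp add: a_def b_def w_def)
  have g1: "gain (Arc False i) = (1 - \<mu>) * \<alpha> - (X z - X w) + \<kappa> * k i"
    unfolding w_def by (rule gain_rev_row[OF parts(1) rows_ii'(1)])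
  have g2: "gain (Arc True i') = \<mu> * \<alpha> - \<kappa> * k i'" by (rule gain_fwd_row[OF rows_ii'(2)])
  have g3: "walk_gain ss \<le> - \<kappa> * (a - w) - max 0 (X w - X a)"
    using short_walk_gain_le[OF parts(2) short] by (simp add: a_def)
  have "real_of_int (b - z) = real_of_int (a - w) - k i + k i'" by (simp add: b_def w_def)
  then have \<kappa>: "\<kappa> * (b - z) = \<kappa> * (a - w) - \<kappa> * k i + \<kappa> * k i'"
    by (simp only: distrib_left right_diff_distrib)
  have "walk_gain ?old = gain (Arc False i) + walk_gain ss + gain (Arc True i')" by simp
  \<comment> \<open>The weights 1 - \<mu> of the reverse arc and \<mu> of the forward arc combine to
    a single \<alpha>.\<close>
  also have "\<dots> \<le> \<alpha> - (X z - X w) - \<kappa> * (b - z) - max 0 (X w - X a)"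
    using g1 g2 g3 \<kappa> by (simp add: algebra_simps)
  \<comment> \<open>Of the two row inequalities, the one for \<open>i\<close> handles the value 0 of
    the maximum and the one for \<open>i'\<close> handles \<open>X z - X b\<close>.\<close>
  also have "\<dots> \<le> - \<kappa> * (b - z) - max 0 (X z - X b)"
    using \<alpha> by (simp add: max_def)
  finally have old: "walk_gain ?old \<le> - \<kappa> * (b - z) - max 0 (X z - X b)" .
  obtain as where "walk z as" "path_len as = b - z" "\<forall>a\<in>set as. \<not> is_row a"
     "walk_gain as = - \<kappa> * (b - z) - max 0 (X z - X (z + (b - z)))"
    using short_walk_exists[of z "b - z"] by blast
  then show ?thesis using old len by (intro exI[of _ as]) simp
qed

section \<open>Reduction of closed walks to circuits\<close>

text \<open>A closed walk that repeats a node splits there into two shorter closed walks, and gains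
  add up.\<close>

lemma closed_walk_without_rev_rows:
  assumes circuits: "\<And>cs. is_circuit m n l k cs \<Longrightarrow> \<forall>a\<in>set cs. is_row a \<longrightarrow> is_fwd a \<Longrightarrow> walk_gain cs \<le> 0"
    and "walk z as" "int n dvd path_len as" "\<forall>a\<in>set as. is_row a \<longrightarrow> is_fwd a"
  shows "walk_gain as \<le> 0"
  using assms(2-)
proof (induction as arbitrary: z rule: length_induct)
  case (1 as)
  show ?case
  proof (cases "distinct (map (tail m n l k) as)")
    case True
    then show ?thesis using circuits walk_circuit 1 by (cases "as = []") auto
  next
    case False
    then obtain xs a ys b zs where as: "as = xs @ (a # ys) @ (b # zs)"
      and tl: "tail m n l k a = tail m n l k b" by (rule not_distinct_map_decomp)
    define z1 where "z1 = z + path_len xs"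
    define z2 where "z2 = z1 + path_len (a # ys)"
    have w: "walk z xs" "walk z1 (a # ys)" "walk z2 (b # zs)"
      using 1(2) unfolding as walk_append by (auto simp: z1_def z2_def add.assoc)
    have mod: "z1 mod int n = z2 mod int n" using w tl by simp
    then have dvd1: "int n dvd path_len (a # ys)"
      by (metis add_diff_cancel_left' dvd_minus_iff minus_diff_eq mod_eq_dvd_iff z2_def)
    have split: "path_len as = path_len (xs @ b # zs) + path_len (a # ys)" by (simp add: as)
    have dvd2: "int n dvd path_len (xs @ b # zs)"
      using 1(3) dvd1 unfolding split by (metis dvd_add_left_iff)
    have w2: "walk z (xs @ b # zs)"
      using w walk_cong[OF mod] unfolding walk_append z1_def by blast
    have "walk_gain (a # ys) \<le> 0"
      by (rule 1(1)[rule_format, OF _ w(2) dvd1]) (use 1(4) as in auto)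
    moreover have "walk_gain (xs @ b # zs) \<le> 0"
      by (rule 1(1)[rule_format, OF _ w2 dvd2]) (use 1(4) as in auto)
    ultimately show ?thesis by (simp add: as)
  qed
qed

lemma dir_sum_row_nonneg: "dir_sum d row_ind as \<ge> 0"
  using dir_sum_mono[of d as "\<lambda>_. 0" row_ind] dir_sum_cmult[of d 0 row_ind as]
  by (simp add: row_ind_def)

text \<open>Induction on the number of row arcs: as long as both directions occur among them, an
  exchange by \<open>replace_rev_fwd\<close> removes two row arcs without lowering the gain.\<close>

lemma closed_walk_gain_le_0:
  assumes circuits: "\<And>cs. is_circuit m n l k cs \<Longrightarrow> \<forall>a\<in>set cs. is_row a \<longrightarrow> is_fwd a \<Longrightarrow> walk_gain cs \<le> 0"
    and "walk z as" "int n dvd path_len as"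
  shows "walk_gain as \<le> 0"
  using assms(2-)
proof (induction "length (filter is_row as)" arbitrary: z as rule: less_induct)
  case less
  consider (no_rev) "\<forall>a\<in>set as. is_row a \<longrightarrow> is_fwd a"
    | (no_fwd) "\<forall>a\<in>set as. is_row a \<longrightarrow> \<not> is_fwd a"
    | (both) "\<exists>a\<in>set as. is_row a \<and> \<not> is_fwd a" "\<exists>a\<in>set as. is_row a \<and> is_fwd a" by blast
  then show ?case
  proof cases
    case no_rev
    then show ?thesis using closed_walk_without_rev_rows[OF circuits less(2,3)] by blast
  next
    case no_fwd
    obtain p where p: "path_len as = int n * p" using less(3) by (rule dvdE)
    have "dir_sum True row_ind as \<le> dir_sum True (\<lambda>i. 0 * row_ind i) as"
      using no_fwd by (intro dir_sum_mono) (force simp: row_ind_def)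
    then have "dir_sum True row_ind as = 0"
      using dir_sum_row_nonneg[of True as] unfolding dir_sum_cmult by simp
    moreover have "\<alpha> * dir_sum False row_ind as \<ge> 0" using dir_sum_row_nonneg alpha_pos by simp
    moreover have "p * \<beta> \<ge> 0" if "p \<ge> 0" using that beta_nonneg by simp
    \<comment> \<open>For p < 0 every r satisfies r \<le> 0 or r \<ge> p, so only p \<ge> 0 needs an
      argument.\<close>
    ultimately have "p \<ge> 0 \<longrightarrow> \<alpha> * (dir_sum True row_ind as - dir_sum False row_ind as) - p * \<beta> \<le> 0"
      by (auto simp flip: of_int_mult)
    then show ?thesis
      using closed_walk_gain_nonpos[OF less(2) p refl] by fastforce
  next
    case both
    then obtain a xs ys where as: "as = xs @ a # ys" and a: "is_row a" "\<not> is_fwd a"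
      by (meson split_list)
    \<comment> \<open>The closed walk is rotated to start with a reverse row arc, so that one
      precedes every forward row arc.\<close>
    define as' where "as' = a # ys @ xs"
    define z' where "z' = z + path_len xs"
    have w0: "walk z xs" "walk z' (a # ys)" using less(2) by (auto simp: as z'_def walk_append)
    have "(z' + path_len (a # ys)) mod int n = z mod int n"
    proof -
      have "z' + path_len (a # ys) = z + path_len as" by (simp add: z'_def as)
      then show ?thesis using less(3) by (metis add.right_neutral dvd_imp_mod_0 mod_add_right_eq)
    qed
    from walk_cong[OF this] w0 have "walk z' ((a # ys) @ xs)" unfolding walk_append by blast
    then have w': "walk z' as'" by (simp only: as'_def append_Cons)
    have same: "path_len as' = path_len as" "walk_gain as' = walk_gain as"
      "length (filter is_row as') = length (filter is_row as)" "set as' = set as"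
      by (auto simp: as as'_def)
    from both(2) same(4) have "\<exists>f\<in>set as'. is_row f \<and> is_fwd f" by simp
    \<comment> \<open>\<open>f\<close> is the first forward row arc and \<open>r\<close> below the
      last reverse row arc before it, so only short arcs lie between them.\<close>
    then obtain us f vs where split1: "as' = us @ f # vs" and f: "is_row f" "is_fwd f"
      and us: "\<forall>u\<in>set us. \<not> (is_row u \<and> is_fwd u)"
      by (rule split_list_first_propE) blast
    have "a \<in> set us" using split1 a f by (cases us) (auto simp: as'_def)
    then have "\<exists>r\<in>set us. is_row r \<and> \<not> is_fwd r" using a by blast
    then obtain ps r ss where split2: "us = ps @ r # ss" and r: "is_row r" "\<not> is_fwd r"
      and ss: "\<forall>u\<in>set ss. \<not> (is_row u \<and> \<not> is_fwd u)"
      by (rule split_list_last_propE) blast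
    obtain i where i: "r = Arc False i" "i \<le> m" using r by (cases r) auto
    obtain i' where i': "f = Arc True i'" "i' \<le> m" using f by (cases f) auto
    let ?mid = "Arc False i # ss @ [Arc True i']"
    have as'_eq: "as' = ps @ ?mid @ vs" using split1 split2 i i' by simp
    define y where "y = z' + path_len ps"
    have w: "walk z' ps" "walk y ?mid" "walk (y + path_len ?mid) vs"
      using w' unfolding as'_eq walk_append y_def by blast+
    obtain sh where sh: "walk y sh" "path_len sh = path_len ?mid" "\<forall>a\<in>set sh. \<not> is_row a"
      "walk_gain ?mid \<le> walk_gain sh"
      using replace_rev_fwd[OF w(2) i(2) i'(2)] us ss split2 by auto
    have fsh: "filter is_row sh = []" using sh(3) by (simp add: filter_empty_conv)
    have "walk_gain (ps @ sh @ vs) \<le> 0"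
    proof (rule less(1))
      show "length (filter is_row (ps @ sh @ vs)) < length (filter is_row as)"
        unfolding same(3)[symmetric] as'_eq using fsh i by simp
      show "walk z' (ps @ sh @ vs)" using w sh(1,2) unfolding walk_append y_def by simp
      have "path_len (ps @ sh @ vs) = path_len as"
        unfolding same(1)[symmetric] as'_eq using sh(2) by simp
      then show "int n dvd path_len (ps @ sh @ vs)" using less(3) by simp
    qed
    moreover have "walk_gain as \<le> walk_gain (ps @ sh @ vs)"
      unfolding same(2)[symmetric] as'_eq using sh(4) by simp
    ultimately show ?thesis by simp
  qed
qed

section \<open>Potentials and the split\<close>

text \<open>The potential at \<open>z\<close> is the supremum of the gains of walks from 0 to the
  residue class of \<open>z\<close>. It is finite because one fixed walk back to 0 closes all of
  them. Appending an arc gives the arc inequality.\<close>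

lemma potential_exists:
  assumes closed: "\<And>z as. walk z as \<Longrightarrow> int n dvd path_len as \<Longrightarrow> walk_gain as \<le> 0"
  shows "\<exists>\<pi>. (\<forall>z. \<pi> (z + int n) = \<pi> z) \<and> (\<forall>z a. walk z [a] \<longrightarrow> \<pi> (z + arc_len m k a) \<ge> \<pi> z + gain a)"
proof -
  define W where "W z = {as. walk 0 as \<and> path_len as mod int n = z mod int n}" for z
  define \<pi> where "\<pi> z = (SUP as\<in>W z. walk_gain as)" for z
  have ne: "W z \<noteq> {}" for z using short_walk_exists[of 0 z] by (auto simp: W_def)
  have bdd: "bdd_above (walk_gain ` W z)" for z
  proof -
    obtain bs where bs: "walk z bs" "path_len bs = - z" using short_walk_exists[of z "- z"] by auto
    have "walk_gain as \<le> - walk_gain bs" if "as \<in> W z" for as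
    proof -
      have "walk 0 (as @ bs)"
        using that bs walk_cong[of "path_len as" z bs] by (simp add: W_def walk_append)
      moreover have "int n dvd path_len (as @ bs)"
        using that bs by (simp add: W_def mod_eq_dvd_iff)
      ultimately have "walk_gain (as @ bs) \<le> 0" by (rule closed)
      then show ?thesis by simp
    qed
    then show ?thesis by (rule bdd_aboveI2)
  qed
  have "\<pi> (z + int n) = \<pi> z" for z by (simp add: \<pi>_def W_def)
  moreover have "\<pi> (z + arc_len m k a) \<ge> \<pi> z + gain a" if a: "walk z [a]" for z a
  proof -
    have "\<pi> z \<le> \<pi> (z + arc_len m k a) - gain a"
      unfolding \<pi>_def[of z]
    proof (rule cSUP_least[OF ne])
      fix as assume as: "as \<in> W z"
      have "as @ [a] \<in> W (z + arc_len m k a)"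
      proof -
        have "walk (path_len as) [a]"
          using a as walk_cong[of "path_len as" z "[a]"] by (simp add: W_def)
        moreover have "(path_len as + arc_len m k a) mod int n = (z + arc_len m k a) mod int n"
          using as by (metis (mono_tags, lifting) W_def mem_Collect_eq mod_add_left_eq)
        ultimately show ?thesis using as by (simp add: W_def walk_append)
      qed
      then have "walk_gain (as @ [a]) \<le> \<pi> (z + arc_len m k a)"
        unfolding \<pi>_def by (rule cSUP_upper[OF _ bdd])
      then show "walk_gain as \<le> \<pi> (z + arc_len m k a) - gain a" by simp
    qed
    then show ?thesis by simp
  qed
  ultimately show ?thesis by blast
qed

lemma split_exists:
  assumes "\<And>z as. walk z as \<Longrightarrow> int n dvd path_len as \<Longrightarrow> walk_gain as \<le> 0"
  shows "\<exists>u. u \<in> Rn n \<and> (\<Sum>j=1..n. u j) = \<mu> * \<beta> \<and> (\<forall>j\<in>{1..n}. 0 \<le> u j \<and> u j \<le> x j)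
    \<and> (\<forall>i\<in>{1..m}. \<mu> * \<alpha> \<le> jump_sum u i \<and> jump_sum u i \<le> jump_sum x i - (1 - \<mu>) * \<alpha>)"
proof -
  have "\<exists>\<pi>. (\<forall>z. \<pi> (z + int n) = \<pi> z)
      \<and> (\<forall>z a. walk z [a] \<longrightarrow> \<pi> (z + arc_len m k a) \<ge> \<pi> z + gain a)"
    by (rule potential_exists) (erule (1) assms)
  then obtain \<pi> where per: "\<forall>z. \<pi> (z + int n) = \<pi> z"
    and "\<forall>z a. walk z [a] \<longrightarrow> \<pi> (z + arc_len m k a) \<ge> \<pi> z + gain a"
    by (elim exE conjE)
  then have pot: "\<pi> (z + arc_len m k a) \<ge> \<pi> z + gain a" if "walk z [a]" for z a
    using that by blast
  \<comment> \<open>Restoring the linear term turns the periodic potential into a lift with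
    increment \<mu>\<beta> per turn.\<close>
  define U where "U z = \<pi> z + \<kappa> * real_of_int z" for z
  define u where "u j = (if j \<in> {1..n} then U (int j) - U (int j - 1) else 0)" for j
  have U: "prefix_lift n u (\<mu> * \<beta>) U"
    using n_pos by (simp add: prefix_lift_def u_def U_def per \<kappa>_def field_simps)
  have arc: "jump_sum u i \<ge> \<mu> * \<alpha> * row_ind i"
    "jump_sum u i \<le> jump_sum x i - (1 - \<mu>) * \<alpha> * row_ind i" if "i \<in> {1..m+n}" for i
  proof -
    define z where "z = fw_tail m n l k i"
    define s where "s = arc_len m k (Arc True i)"
    have mem: "Arc d i \<in> arc_set m n" for d using that by (auto simp: arc_set_def)
    have zmod: "fw_tail m n l k i = z mod int n" by (simp add: z_def fw_tail_def)
    have hd: "fw_head m n l k i = (z + s) mod int n"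
      using head_eq[of "Arc True i" z] zmod by (simp add: s_def)
    have js: "jump_sum u i = \<pi> (z + s) - \<pi> z + \<kappa> * s"
      using jump_sum_fwd[OF U mem[of True] zmod] by (simp add: s_def U_def algebra_simps)
    have lenF: "arc_len m k (Arc False i) = - s" by (simp add: s_def)
    have "walk z [Arc True i]" using mem zmod by simp
    from pot[OF this] show "jump_sum u i \<ge> \<mu> * \<alpha> * row_ind i"
      using js unfolding gain.simps s_def[symmetric] by simp
    have "walk (z + s) [Arc False i]" using mem hd by simp
    from pot[OF this] show "jump_sum u i \<le> jump_sum x i - (1 - \<mu>) * \<alpha> * row_ind i"
      using js unfolding gain.simps lenF by simp
  qed
  have "0 \<le> u j \<and> u j \<le> x j" if j: "j \<in> {1..n}" for j
  proof -
    have "jump_sum y (m + j) = y j" for y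
    proof -
      have "{i. i \<in> {1..n} \<and> jumps m n l k (m + j) i} = {j}" using j by (auto simp: jumps_def)
      then show ?thesis by (simp add: jump_sum_def)
    qed
    moreover have "row_ind (m + j) = 0" using j by (simp add: row_ind_def)
    ultimately show ?thesis using arc[of "m + j"] j by simp
  qed
  moreover have "\<mu> * \<alpha> \<le> jump_sum u i \<and> jump_sum u i \<le> jump_sum x i - (1 - \<mu>) * \<alpha>"
    if "i \<in> {1..m}" for i
    using arc[of i] that by (simp add: row_ind_def)
  moreover have "u \<in> Rn n" by (simp add: Rn_def u_def)
  moreover have "(\<Sum>j=1..n. u j) = \<mu> * \<beta>" by (rule prefix_lift_sum[OF U n_pos])
  ultimately show ?thesis by blast
qed

end

text \<open>Here r is formed with the fixed \<beta>, not with \<open>t div p\<close>. If 0 < r < p,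
  then \<beta> does equal \<open>t div p\<close>, p \<ge> 2 and p does not divide t, so the
  \<Gamma>-inequality is available; otherwise the row constraints suffice.\<close>

lemma (in covering_point) circuit_gain_nonpos:
  assumes circuit: "is_circuit m n l k cs"
    and gamma: "winding m n k cs \<ge> 2 \<Longrightarrow> \<not> winding m n k cs dvd t_val m cs (\<lambda>_. \<alpha>)
      \<Longrightarrow> x \<in> gamma_ineq m n l k cs (\<lambda>_. \<alpha>)"
  shows "walk_gain cs \<le> 0"
proof -
  define p where "p = winding m n k cs"
  define t where "t = t_val m cs (\<lambda>_. \<alpha>)"
  define r where "r = t - \<beta> * p"
  have walk: "walk (tail m n l k (hd cs)) cs" and len: "path_len cs = int n * p"
    using circuit_walk(1,2)[OF circuit] by (simp_all add: p_def)
  have r: "real_of_int r = \<alpha> * (dir_sum True row_ind cs - dir_sum False row_ind cs) - p * \<beta>"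
    using circuit_t_val[OF circuit, of \<alpha>] by (simp add: r_def t_def)
  show ?thesis
  proof (cases "r \<le> 0 \<or> r \<ge> p")
    case True
    then show ?thesis using closed_walk_gain_nonpos[OF walk len r] by simp
  next
    case False
    then have "p \<ge> 2" by linarith
    have \<beta>: "\<beta> = t div p"
      using False by (intro int_div_pos_eq[symmetric, of t p \<beta> r]) (auto simp: r_def)
    moreover have "\<not> p dvd t"
    proof
      assume "p dvd t"
      then have "p dvd r" by (simp add: r_def)
      with False show False using zdvd_imp_le by force
    qed
    ultimately have "x \<in> gamma_ineq m n l k cs (\<lambda>_. \<alpha>)"
      using gamma \<open>p \<ge> 2\<close> by (simp add: p_def t_def)
    then have "dir_sum False (jump_sum x) cs + r * (real_of_int \<beta> + 1 - \<mu>)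
        \<ge> r * (\<beta> + 1) + \<alpha> * dir_sum False row_ind cs"
      unfolding gamma_ineq_iff[OF circuit p_def t_def \<beta> r_def] prefix_lift_sum[OF lift n_pos] .
    then show ?thesis
      unfolding closed_walk_gain[OF walk len r] by (simp add: algebra_simps)
  qed
qed

lemma (in covering_point) point_split:
  assumes gamma: "\<And>cs. is_circuit m n l k cs \<Longrightarrow> \<forall>i\<in>{1..m}. Arc False i \<notin> set cs
      \<Longrightarrow> winding m n k cs \<ge> 2 \<Longrightarrow> \<not> winding m n k cs dvd t_val m cs (\<lambda>_. \<alpha>)
      \<Longrightarrow> x \<in> gamma_ineq m n l k cs (\<lambda>_. \<alpha>)"
  shows "\<exists>u. u \<in> Rn n \<and> (\<Sum>j=1..n. u j) = \<mu> * \<beta> \<and> (\<forall>j\<in>{1..n}. 0 \<le> u j \<and> u j \<le> x j)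
    \<and> (\<forall>i\<in>{1..m}. \<mu> * \<alpha> \<le> jump_sum u i \<and> jump_sum u i \<le> jump_sum x i - (1 - \<mu>) * \<alpha>)"
proof (rule split_exists)
  fix z as assume as: "walk z as" "int n dvd path_len as"
  show "walk_gain as \<le> 0"
  proof (rule closed_walk_gain_le_0[OF _ as])
    fix cs assume cs: "is_circuit m n l k cs" "\<forall>a\<in>set cs. is_row a \<longrightarrow> is_fwd a"
    then have "\<forall>i\<in>{1..m}. Arc False i \<notin> set cs" by fastforce
    with cs(1) gamma show "walk_gain cs \<le> 0" by (intro circuit_gain_nonpos) auto
  qed
qed

section \<open>Convexity and the description of the hull\<close>

lemma convex_halfspace_fun:
  "convex {x :: nat \<Rightarrow> real. (\<Sum>j\<in>J. c j * x j) \<ge> d}"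
proof (rule convexI)
  fix x y :: "nat \<Rightarrow> real" and u v :: real
  assume xy: "x \<in> {x. (\<Sum>j\<in>J. c j * x j) \<ge> d}" "y \<in> {x. (\<Sum>j\<in>J. c j * x j) \<ge> d}"
    and uv: "0 \<le> u" "0 \<le> v" "u + v = 1"
  have "d = u * d + v * d" using uv(3) by (metis distrib_right mult_1)
  also have "\<dots> \<le> u * (\<Sum>j\<in>J. c j * x j) + v * (\<Sum>j\<in>J. c j * y j)"
    using xy uv by (intro add_mono mult_left_mono) auto
  also have "\<dots> = (\<Sum>j\<in>J. c j * (u *\<^sub>R x + v *\<^sub>R y) j)"
    by (simp add: scaleR_fun_def sum_distrib_left sum.distrib algebra_simps)
  finally show "u *\<^sub>R x + v *\<^sub>R y \<in> {x. (\<Sum>j\<in>J. c j * x j) \<ge> d}" by simp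
qed

lemma convex_Rn: "convex (Rn n)"
  by (auto simp: convex_def Rn_def scaleR_fun_def)

lemma circular_wrt_arcs:
  assumes "circular_wrt A m n l k" "n > 0"
  shows "circular_arcs m n k"
proof
  fix i assume "i \<in> {1..m}"
  then have "k i \<le> n - 1" using assms(1) by (simp add: circular_wrt_def)
  then show "k i \<le> n" by simp
qed (fact assms(2))

theorem theorem5p3:
  fixes A :: "nat \<Rightarrow> nat \<Rightarrow> int" and m n :: nat and l k :: "nat \<Rightarrow> nat" and \<alpha> :: int
  assumes circ: "circular_wrt A m n l k"
    and nodom: "no_dominating_rows A m n"
    and alpha_pos: "\<alpha> > 0"
  shows "Qstar A m n (\<lambda>_. \<alpha>) =
           {x \<in> Rn n. (\<forall>i\<in>{1..m}. (\<Sum>j=1..n. real_of_int (A i j) * x j) \<ge> real_of_int \<alpha>)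
              \<and> (\<forall>j\<in>{1..n}. x j \<ge> 0)
              \<and> (\<forall>cs. is_circuit m n l k cs
                   \<and> (\<forall>i\<in>{1..m}. Arc False i \<notin> set cs)
                   \<and> winding m n k cs \<ge> 2
                   \<and> \<not> (winding m n k cs dvd t_val m cs (\<lambda>_. \<alpha>))
                   \<longrightarrow> x \<in> gamma_ineq m n l k cs (\<lambda>_. \<alpha>))}"
    (is "_ = ?P")
proof (cases "n = 0")
  case True
  \<comment> \<open>In the degenerate case there are neither rows nor arcs, and both sides are the
    single point 0.\<close>
  have "l i \<in> {1..n}" if "i \<in> {1..m}" for i using circ that by (simp add: circular_wrt_def)
  then have "m = 0" using True by (cases "m = 0") fastforce+
  then have "\<not> is_circuit m n l k cs" for cs
    using True by (cases cs) (auto simp: is_circuit_def arc_set_def)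
  then have "?P = Rn n" using True \<open>m = 0\<close> by simp
  moreover have "Qpoly A m n (\<lambda>_. \<alpha>) \<inter> int_points n = Rn n"
    using True \<open>m = 0\<close> by (auto simp: Qpoly_def int_points_def)
  ultimately show ?thesis
    by (simp add: Qstar_def hull_same convex_Rn)
next
  case False
  then have n: "n > 0" by simp
  interpret circular_arcs m n l k by (rule circular_wrt_arcs[OF circ n])
  have row_eq: "(\<Sum>j=1..n. real_of_int (A i j) * x j) = jump_sum x i" if "i \<in> {1..m}" for i x
    using row_sum[OF circ that] jump_sum_row[OF that] by simp
  show ?thesis
  proof
    have "Qpoly A m n (\<lambda>_. \<alpha>) \<inter> int_points n \<subseteq> ?P"
    proof
      fix x assume x: "x \<in> Qpoly A m n (\<lambda>_. \<alpha>) \<inter> int_points n"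
      then have "(\<Sum>j=1..n. x j) \<in> \<int>" by (auto simp: int_points_def)
      then obtain s where s: "(\<Sum>j=1..n. x j) = real_of_int s" by (elim Ints_cases)
      have "x \<in> gamma_ineq m n l k cs (\<lambda>_. \<alpha>)"
        if "is_circuit m n l k cs" "winding m n k cs \<ge> 2" for cs
        using that x row_eq s by (intro integral_point_gamma_ineq[where s = s]) (auto simp: Qpoly_def)
      then show "x \<in> ?P" using x by (simp add: Qpoly_def)
    qed
    moreover have "convex ?P"
    proof -
      \<comment> \<open>Nonnegativity is written as a one-term sum to fit
        \<open>convex_halfspace_fun\<close>.\<close>
      have "?P = Rn n
          \<inter> (\<Inter>i\<in>{1..m}. {x. (\<Sum>j=1..n. real_of_int (A i j) * x j) \<ge> real_of_int \<alpha>})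
          \<inter> (\<Inter>j\<in>{1..n}. {x. (\<Sum>i\<in>{j}. 1 * x i) \<ge> 0})
          \<inter> (\<Inter>cs\<in>{cs. is_circuit m n l k cs \<and> (\<forall>i\<in>{1..m}. Arc False i \<notin> set cs)
                   \<and> winding m n k cs \<ge> 2 \<and> \<not> (winding m n k cs dvd t_val m cs (\<lambda>_. \<alpha>))}.
               gamma_ineq m n l k cs (\<lambda>_. \<alpha>))"
        by auto
      also have "convex \<dots>"
        unfolding gamma_ineq_def Let_def
        by (intro convex_Int convex_INT convex_Rn convex_halfspace_fun)
      finally show ?thesis .
    qed
    ultimately show "Qstar A m n (\<lambda>_. \<alpha>) \<subseteq> ?P"
      unfolding Qstar_def by (rule hull_minimal)
  next
    show "?P \<subseteq> Qstar A m n (\<lambda>_. \<alpha>)"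
    proof
      fix x assume x: "x \<in> ?P"
      then have xQ: "x \<in> Qpoly A m n (\<lambda>_. \<alpha>)" by (simp add: Qpoly_def)
      define s where "s = (\<Sum>j=1..n. x j)"
      define \<beta> where "\<beta> = \<lfloor>s\<rfloor>"
      define \<mu> where "\<mu> = real_of_int \<beta> + 1 - s"
      have \<mu>: "0 < \<mu>" "\<mu> \<le> 1" unfolding \<mu>_def \<beta>_def by linarith+
      have s0: "s \<ge> 0" unfolding s_def using x by (intro sum_nonneg) simp
      show "x \<in> Qstar A m n (\<lambda>_. \<alpha>)"
      proof (cases "\<mu> = 1")
        \<comment> \<open>The coordinate sum is then integral, and \<open>x\<close> lies in a single
          slice.\<close>
        case True
        then have "(\<Sum>j=1..n. x j) = real_of_int \<beta>" by (simp add: \<mu>_def s_def)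
        with integral_slice[OF circ n xQ] show ?thesis by blast
      next
        case False
        with \<mu> have \<mu>1: "\<mu> < 1" by simp
        have c: "real_of_int \<beta> + 1 - \<mu> = s" by (simp add: \<mu>_def)
        obtain X where X: "prefix_lift n x s X"
          using prefix_lift_exists[OF n] unfolding s_def by blast
        interpret covering_point m n l k x X \<alpha> \<beta> \<mu>
        proof
          show "prefix_lift n x (real_of_int \<beta> + 1 - \<mu>) X" unfolding c by (rule X)
          show "\<beta> \<ge> 0" using s0 by (simp add: \<beta>_def)
        qed (use x row_eq \<mu> alpha_pos in auto)
        obtain u where u: "u \<in> Rn n" "(\<Sum>j=1..n. u j) = \<mu> * \<beta>"
          "\<And>j. j \<in> {1..n} \<Longrightarrow> 0 \<le> u j \<and> u j \<le> x j"
          "\<And>i. i \<in> {1..m} \<Longrightarrow> \<mu> * \<alpha> \<le> jump_sum u i \<and> jump_sum u i \<le> jump_sum x i - (1 - \<mu>) * \<alpha>"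
          using point_split x by auto
        \<comment> \<open>Rescaling the two parts of \<open>x\<close> puts them into the slices
          \<beta> and \<beta> + 1, and \<open>x\<close> is their combination with weights \<mu> and
          1 - \<mu>.\<close>
        define y where "y = (\<lambda>j. u j / \<mu>)"
        define z where "z = (\<lambda>j. (x j - u j) / (1 - \<mu>))"
        have jy: "jump_sum y i = jump_sum u i / \<mu>" for i
          by (simp add: jump_sum_def y_def sum_divide_distrib)
        have jz: "jump_sum z i = (jump_sum x i - jump_sum u i) / (1 - \<mu>)" for i
          by (simp add: jump_sum_def z_def sum_divide_distrib[symmetric] sum_subtractf)
        have "real_of_int \<alpha> \<le> jump_sum y i" if "i \<in> {1..m}" for i
          using u(4)[OF that] \<mu> by (simp add: jy pos_le_divide_eq mult.commute)
        moreover have "y \<in> Rn n" "\<forall>j\<in>{1..n}. y j \<ge> 0"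
          using u(1,3) \<mu> by (auto simp: Rn_def y_def)
        ultimately have "y \<in> Qpoly A m n (\<lambda>_. \<alpha>)" using row_eq by (auto simp: Qpoly_def)
        moreover have "(\<Sum>j=1..n. y j) = real_of_int \<beta>"
          using u(2) \<mu> by (simp add: y_def sum_divide_distrib[symmetric])
        ultimately have yQ: "y \<in> Qstar A m n (\<lambda>_. \<alpha>)" by (rule integral_slice[OF circ n])
        have "real_of_int \<alpha> \<le> jump_sum z i" if "i \<in> {1..m}" for i
          using u(4)[OF that] \<mu>1 by (simp add: jz pos_le_divide_eq mult.commute)
        moreover have "z \<in> Rn n" "\<forall>j\<in>{1..n}. z j \<ge> 0"
          using u(1,3) x \<mu>1 by (auto simp: Rn_def z_def)
        ultimately have "z \<in> Qpoly A m n (\<lambda>_. \<alpha>)" using row_eq by (auto simp: Qpoly_def)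
        moreover have "(\<Sum>j=1..n. z j) = real_of_int (\<beta> + 1)"
        proof -
          have "(\<Sum>j=1..n. z j) = (s - \<mu> * \<beta>) / (1 - \<mu>)"
            using u(2) by (simp add: z_def s_def sum_divide_distrib[symmetric] sum_subtractf)
          also have "s - \<mu> * \<beta> = (1 - \<mu>) * (\<beta> + 1)" by (simp add: \<mu>_def algebra_simps)
          finally show ?thesis using \<mu>1 by simp
        qed
        ultimately have zQ: "z \<in> Qstar A m n (\<lambda>_. \<alpha>)" by (rule integral_slice[OF circ n])
        have "x = \<mu> *\<^sub>R y + (1 - \<mu>) *\<^sub>R z"
          using \<mu> \<mu>1 by (auto simp: fun_eq_iff scaleR_fun_def y_def z_def)
        moreover have "\<mu> *\<^sub>R y + (1 - \<mu>) *\<^sub>R z \<in> Qstar A m n (\<lambda>_. \<alpha>)"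
          using yQ zQ \<mu> unfolding Qstar_def by (intro convexD[OF convex_convex_hull]) auto
        ultimately show ?thesis by simp
      qed
    qed
  qed
qed

end
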